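(* Suppose $\frac{\lambda}{n}\in\big[6\sigma_0^2\frac{(|\tau_0|+1)\log(p/2)}{n}+t,\ 0.05\,C_{\min}\big]$ for a positive constant $t>0$. Then for any finite $d\ge1$, $$\begin{aligned}\mathbb P_{(\mathcal U^d,Y)}\big(\tau_0\notin S^{(d)}\big)\le{}&6\exp\Big[-\frac{n}{18\sigma_0^2}\Big\{0.3C_{\min}-36\frac{\log(p+1)}{n}\sigma_0^2\Big\}\Big]+3\exp\Big(-\frac{nt}{3\sigma_0^2}\Big)\\&+\exp\Big\{-nd\Big(0.23-\frac{|\tau_0|\log(p)+2}{n}\Big)\Big\}.\end{aligned}$$ Therefore, for any $d$, $\mathbb P_{(\mathcal U^d,Y)}(\tau_0\notin S^{(d)})\to0$ as $n\to\infty$, if $\frac{|\tau_0|\log(p)}{n}<0.23$ and $C_{\min}>120\frac{(|\tau_0|+2)\log(p+1)}{n}\sigma_0^2$ when $n$ is large enough.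
   Context: Setting. $n,p$ are positive integers and $X\in\mathbb R^{n\times p}$ is a fixed matrix. For $\tau\subset[p]=\{1,\dots,p\}$ (a "model"), $X_\tau$ is the submatrix of the columns of $X$ indexed by $\tau$ and $|\tau|$ is the cardinality. The data are $Y=X_{\tau_0}\beta_0+\sigma_0U$, where $\tau_0\subset[p]$ (nonempty), $\beta_0\in\mathbb R^{|\tau_0|}$, $\sigma_0>0$ are fixed and $U\sim N(0,I_n)$. Identifiability: $\tau_0$ is the unique model of smallest cardinality in $\{\tau\subset[p]: X_\tau\beta_\tau=X_{\tau_0}\beta_0\text{ for some }\beta_\tau\in\mathbb R^{|\tau|}\}$. Define $$C_{\min}=\min_{\tau\ne\tau_0,\ |\tau|\le|\tau_0|}\ \min_{\beta_\tau\in\mathbb R^{|\tau|}}\ \frac{\|X_{\tau_0}\beta_0-X_\tau\beta_\tau\|_2^2}{n\max(|\tau_0\setminus\tau|,1)},$$ so that $C_{\min}>0$ by identifiability. Candidate set. Let $\mathcal U^d=(U_1^*,\dots,U_d^* )$ be i.i.d. $N(0,I_n)$, independent of $U$. For $\lambda>0$ let $$\hat\tau_b=\arg\min_{\tau\subset[p]}\ \min_{\beta_\tau\in\mathbb R^{|\tau|},\,\sigma\in\mathbb R}\big\{\|Y-X_\tau\beta_\tau-\sigma U_b^*\|_2^2+\lambda|\tau|\big\},\quad b=1,\dots,d$$ (with a fixed tie-breaking rule), and $S^{(d)}=\{\hat\tau_b:b=1,\dots,d\}$. $\mathbb P_{(\mathcal U^d,Y)}$ is the joint probability over $U$ and $\mathcal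 U^d$. In the asymptotic statement one considers a sequence of such problems indexed by $n$, where $p,X,\tau_0,\beta_0,\lambda$ may depend on $n$ (with $\lambda$ in the stated range), and $d,t,\sigma_0$ are fixed. *)

theory Defs
  imports "HOL-Probability.Probability"
begin

text \<open>
  Since the dimensions vary inside the statements, vectors in \<open>\<real>\<^sup>n\<close> are functions on
  \<open>{1..n}\<close> and an \<open>n \<times> p\<close> matrix is a function of a row index in \<open>{1..n}\<close> and a column index
  in \<open>{1..p}\<close>; values outside these ranges are never used. A model is a subset \<open>\<tau>\<close> of
  \<open>{1..p}\<close>, and a coefficient vector in \<open>\<real>\<^bsup>|\<tau>|\<^esup>\<close> is indexed by the elements of \<open>\<tau>\<close>: of
  \<open>\<beta> :: nat \<Rightarrow> real\<close> only the values on \<open>\<tau>\<close> matter.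
\<close>

text \<open>The vector \<open>X\<^sub>\<tau> \<beta>\<close>.\<close>

definition lin :: "(nat \<Rightarrow> nat \<Rightarrow> real) \<Rightarrow> nat set \<Rightarrow> (nat \<Rightarrow> real) \<Rightarrow> nat \<Rightarrow> real" where
  "lin X \<tau> \<beta> i = (\<Sum>j\<in>\<tau>. X i j * \<beta> j)"

text \<open>Squared Euclidean norm on \<open>\<real>\<^sup>n\<close>.\<close>

definition norm2_sq :: "nat \<Rightarrow> (nat \<Rightarrow> real) \<Rightarrow> real" where
  "norm2_sq n v = (L2_set v {1..n})\<^sup>2"

text \<open>\<open>\<tau>\<^sub>0\<close> is the unique model of smallest cardinality that reproduces the mean \<open>X\<^bsub>\<tau>\<^sub>0\<^esub> \<beta>\<^sub>0\<close>.\<close>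

definition identifiable ::
    "nat \<Rightarrow> nat \<Rightarrow> (nat \<Rightarrow> nat \<Rightarrow> real) \<Rightarrow> nat set \<Rightarrow> (nat \<Rightarrow> real) \<Rightarrow> bool" where
  "identifiable n p X \<tau>\<^sub>0 \<beta>\<^sub>0 \<longleftrightarrow>
     {\<tau>. is_arg_min card
           (\<lambda>\<tau>. \<tau> \<subseteq> {1..p} \<and> (\<exists>\<beta>. \<forall>i\<in>{1..n}. lin X \<tau> \<beta> i = lin X \<tau>\<^sub>0 \<beta>\<^sub>0 i)) \<tau>} = {\<tau>\<^sub>0}"

text \<open>
  The inner infimum is a minimum (the squared distance to a linear subspace of \<open>\<real>\<^sup>n\<close>). For
  nonempty \<open>\<tau>\<^sub>0\<close> the outer minimum is over a finite set that contains the empty model.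
\<close>

definition C_min ::
    "nat \<Rightarrow> nat \<Rightarrow> (nat \<Rightarrow> nat \<Rightarrow> real) \<Rightarrow> nat set \<Rightarrow> (nat \<Rightarrow> real) \<Rightarrow> real" where
  "C_min n p X \<tau>\<^sub>0 \<beta>\<^sub>0 =
     Min ((\<lambda>\<tau>. INF \<beta>. norm2_sq n (\<lambda>i. lin X \<tau>\<^sub>0 \<beta>\<^sub>0 i - lin X \<tau> \<beta> i)
                        / (real n * real (max (card (\<tau>\<^sub>0 - \<tau>)) 1)))
          ` {\<tau>. \<tau> \<subseteq> {1..p} \<and> \<tau> \<noteq> \<tau>\<^sub>0 \<and> card \<tau> \<le> card \<tau>\<^sub>0})"

text \<open>The distribution \<open>N(0, I\<^sub>n)\<close>.\<close>

definition std_normal_vec :: "nat \<Rightarrow> (nat \<Rightarrow> real) measure" where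
  "std_normal_vec n = (\<Pi>\<^sub>M i\<in>{1..n}. std_normal_distribution)"

text \<open>
  \<open>U\<^sup>*\<^sub>1, \<dots>, U\<^sup>*\<^sub>d\<close> are i.i.d. \<open>N(0, I\<^sub>n)\<close> and independent of \<open>U \<sim> N(0, I\<^sub>n)\<close>. Equivalently, the
  family \<open>U, U\<^sup>*\<^sub>1, \<dots>, U\<^sup>*\<^sub>d\<close> is mutually independent; \<open>U\<close> is given the index \<open>0\<close>.
\<close>

definition gaussian_noise ::
    "'a measure \<Rightarrow> nat \<Rightarrow> nat \<Rightarrow> ('a \<Rightarrow> nat \<Rightarrow> real) \<Rightarrow> (nat \<Rightarrow> 'a \<Rightarrow> nat \<Rightarrow> real) \<Rightarrow> bool" where
  "gaussian_noise M n d U Ustar \<longleftrightarrow>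
     prob_space M \<and>
     prob_space.indep_vars M (\<lambda>_. std_normal_vec n) (\<lambda>b. if b = 0 then U else Ustar b) {0..d} \<and>
     distr M (std_normal_vec n) U = std_normal_vec n \<and>
     (\<forall>b\<in>{1..d}. distr M (std_normal_vec n) (Ustar b) = std_normal_vec n)"

definition repro_model ::
    "'a measure \<Rightarrow> nat \<Rightarrow> ('a \<Rightarrow> nat \<Rightarrow> real) \<Rightarrow> (nat \<Rightarrow> 'a \<Rightarrow> nat \<Rightarrow> real) \<Rightarrow> nat \<Rightarrow> nat \<Rightarrow>
     (nat \<Rightarrow> nat \<Rightarrow> real) \<Rightarrow> nat set \<Rightarrow> (nat \<Rightarrow> real) \<Rightarrow> bool" where
  "repro_model M d U Ustar n p X \<tau>\<^sub>0 \<beta>\<^sub>0 \<longleftrightarrow>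
     0 < n \<and> 0 < p \<and> \<tau>\<^sub>0 \<subseteq> {1..p} \<and> \<tau>\<^sub>0 \<noteq> {} \<and>
     identifiable n p X \<tau>\<^sub>0 \<beta>\<^sub>0 \<and> gaussian_noise M n d U Ustar"

text \<open>The data \<open>Y = X\<^bsub>\<tau>\<^sub>0\<^esub> \<beta>\<^sub>0 + \<sigma>\<^sub>0 U\<close>, at a realisation \<open>u\<close> of \<open>U\<close>.\<close>

definition response ::
    "(nat \<Rightarrow> nat \<Rightarrow> real) \<Rightarrow> nat set \<Rightarrow> (nat \<Rightarrow> real) \<Rightarrow> real \<Rightarrow> (nat \<Rightarrow> real) \<Rightarrow> nat \<Rightarrow> real" where
  "response X \<tau>\<^sub>0 \<beta>\<^sub>0 \<sigma>\<^sub>0 u i = lin X \<tau>\<^sub>0 \<beta>\<^sub>0 i + \<sigma>\<^sub>0 * u i"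

text \<open>The infimum is a minimum, again by projection onto a linear subspace of \<open>\<real>\<^sup>n\<close>.\<close>

definition criterion ::
    "nat \<Rightarrow> (nat \<Rightarrow> nat \<Rightarrow> real) \<Rightarrow> real \<Rightarrow> (nat \<Rightarrow> real) \<Rightarrow> (nat \<Rightarrow> real) \<Rightarrow> nat set \<Rightarrow> real" where
  "criterion n X lam y u \<tau> =
     (INF (\<beta>, \<sigma>). norm2_sq n (\<lambda>i. y i - lin X \<tau> \<beta> i - \<sigma> * u i) + lam * real (card \<tau>))"

text \<open>A tie-breaking rule selects one element of each nonempty set of minimising models.\<close>

definition tie_breaking :: "(nat set set \<Rightarrow> nat set) \<Rightarrow> bool" where
  "tie_breaking tb \<longleftrightarrow> (\<forall>A. A \<noteq> {} \<longrightarrow> tb A \<in> A)"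

definition tau_hat ::
    "(nat set set \<Rightarrow> nat set) \<Rightarrow> nat \<Rightarrow> nat \<Rightarrow> (nat \<Rightarrow> nat \<Rightarrow> real) \<Rightarrow> real \<Rightarrow>
     (nat \<Rightarrow> real) \<Rightarrow> (nat \<Rightarrow> real) \<Rightarrow> nat set" where
  "tau_hat tb n p X lam y u = tb {\<tau>. is_arg_min (criterion n X lam y u) (\<lambda>\<tau>. \<tau> \<subseteq> {1..p}) \<tau>}"

text \<open>
  The candidate set \<open>S\<^bsup>(d)\<^esup>\<close>. Events about it are measurable: for each \<open>\<tau>\<close> the criterion is an
  infimum of continuous functions of \<open>(y, u)\<close>, and \<open>tau_hat\<close> depends on \<open>(y, u)\<close> only through
  the set of minimisers, which takes finitely many values.
\<close>

definition candidate_set ::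
    "(nat set set \<Rightarrow> nat set) \<Rightarrow> nat \<Rightarrow> nat \<Rightarrow> nat \<Rightarrow> (nat \<Rightarrow> nat \<Rightarrow> real) \<Rightarrow> real \<Rightarrow>
     (nat \<Rightarrow> real) \<Rightarrow> (nat \<Rightarrow> nat \<Rightarrow> real) \<Rightarrow> nat set set" where
  "candidate_set tb d n p X lam y us = (\<lambda>b. tau_hat tb n p X lam y (us b)) ` {1..d}"

definition miss_prob ::
    "'a measure \<Rightarrow> (nat set set \<Rightarrow> nat set) \<Rightarrow> nat \<Rightarrow> ('a \<Rightarrow> nat \<Rightarrow> real) \<Rightarrow>
     (nat \<Rightarrow> 'a \<Rightarrow> nat \<Rightarrow> real) \<Rightarrow> nat \<Rightarrow> nat \<Rightarrow> (nat \<Rightarrow> nat \<Rightarrow> real) \<Rightarrow> nat set \<Rightarrow>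
     (nat \<Rightarrow> real) \<Rightarrow> real \<Rightarrow> real \<Rightarrow> real" where
  "miss_prob M tb d U Ustar n p X \<tau>\<^sub>0 \<beta>\<^sub>0 \<sigma>\<^sub>0 lam =
     \<P>(\<omega> in M. \<tau>\<^sub>0 \<notin> candidate_set tb d n p X lam
                        (response X \<tau>\<^sub>0 \<beta>\<^sub>0 \<sigma>\<^sub>0 (U \<omega>)) (\<lambda>b. Ustar b \<omega>))"

end

theory Submission
  imports Defs "HOL-Real_Asymp.Real_Asymp"
begin

text \<open>
  A repro noise \<open>u\<close> is good if, for every wrong model \<open>\<tau>\<close> with \<open>|\<tau>| \<le> |\<tau>\<^sub>0|\<close>, adding \<open>u\<close> to the columns of
  \<open>X\<^sub>\<tau>\<close> leaves at least a fraction \<open>0.3\<close> of the squared distance of the mean to their span. This fails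
  only if \<open>u\<close> is nearly aligned with a fixed direction; each alignment is exponentially unlikely and
  there are at most \<open>p ^ |\<tau>\<^sub>0|\<close> of them, which gives the third term.

  Fix a good \<open>u\<close>, and suppose that \<open>\<tau>\<close> beats \<open>\<tau>\<^sub>0\<close>. If \<open>|\<tau>| \<le> |\<tau>\<^sub>0|\<close>, then a Gaussian linear form in
  \<open>U\<close> or a \<open>\<chi>\<^sup>2\<close> variable with \<open>|\<tau> - \<tau>\<^sub>0|\<close> degrees of freedom exceeds a multiple of
  \<open>n C_min |\<tau>\<^sub>0 - \<tau>|\<close>; summing over \<open>\<tau>\<close> gives the first term. If \<open>|\<tau>| > |\<tau>\<^sub>0|\<close>, then such a variable
  exceeds \<open>\<lambda> (|\<tau>| - |\<tau>\<^sub>0|)\<close>; this variable depends on \<open>\<tau>\<close> only through \<open>\<tau> - \<tau>\<^sub>0\<close>, and summing over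
  these sets gives the second term. As \<open>U\<close> is independent of the repro noises, one may condition on
  them: either all are bad, or the bound for a single good one applies.

  The limit does not follow from the finite-sample bound, whose third term need not vanish when
  \<open>|\<tau>\<^sub>0| log p / n\<close> approaches \<open>0.23\<close>. It uses the sharper rate \<open>(n - |\<tau>\<^sub>0|) / 2\<close> for bad noises.
\<close>

section \<open>Orthogonal projections\<close>

definition ip :: "nat \<Rightarrow> (nat \<Rightarrow> real) \<Rightarrow> (nat \<Rightarrow> real) \<Rightarrow> real" where
  "ip n x y = (\<Sum>i\<in>{1..n}. x i * y i)"

lemma norm2_sq_ip: "norm2_sq n v = ip n v v"
  by (simp add: norm2_sq_def L2_set_def ip_def sum_nonneg power2_eq_square)

lemma ip_cong:
  assumes "\<And>i. i \<in> {1..n} \<Longrightarrow> x i = x' i" "\<And>i. i \<in> {1..n} \<Longrightarrow> y i = y' i"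
  shows "ip n x y = ip n x' y'"
  using assms unfolding ip_def by (intro sum.cong) auto

lemma ip_commute: "ip n x y = ip n y x"
  by (simp add: ip_def mult.commute)

lemma ip_add_right: "ip n x (\<lambda>i. y i + z i) = ip n x y + ip n x z"
  by (simp add: ip_def algebra_simps sum.distrib)

lemma ip_diff_right: "ip n x (\<lambda>i. y i - z i) = ip n x y - ip n x z"
  by (simp add: ip_def algebra_simps sum_subtractf)

lemma ip_scale_right: "ip n x (\<lambda>i. c * y i) = c * ip n x y"
  by (simp add: ip_def algebra_simps sum_distrib_left)

lemma ip_divide_right: "ip n x (\<lambda>i. y i / c) = ip n x y / c"
  by (simp add: ip_def sum_divide_distrib)

lemma ip_sum_right: "ip n x (\<lambda>i. \<Sum>l\<in>L. y l i) = (\<Sum>l\<in>L. ip n x (y l))"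
  unfolding ip_def sum_distrib_left by (rule sum.swap)

lemma ip_add_left: "ip n (\<lambda>i. y i + z i) x = ip n y x + ip n z x"
  and ip_diff_left: "ip n (\<lambda>i. y i - z i) x = ip n y x - ip n z x"
  and ip_scale_left: "ip n (\<lambda>i. c * y i) x = c * ip n y x"
  and ip_divide_left: "ip n (\<lambda>i. y i / c) x = ip n y x / c"
  and ip_sum_left: "ip n (\<lambda>i. \<Sum>l\<in>L. w l i) x = (\<Sum>l\<in>L. ip n (w l) x)"
  by (simp_all add: ip_commute[of _ _ x] ip_add_right ip_diff_right ip_scale_right
      ip_divide_right ip_sum_right)

lemmas ip_simps = ip_add_right ip_diff_right ip_scale_right ip_divide_right ip_sum_right
  ip_add_left ip_diff_left ip_scale_left ip_divide_left ip_sum_left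

lemma ip_self_nonneg: "0 \<le> ip n x x"
  by (simp add: ip_def sum_nonneg)

lemma ip_self_zero:
  assumes "ip n x x = 0" "i \<in> {1..n}"
  shows "x i = 0"
proof -
  have "(\<Sum>i\<in>{1..n}. x i * x i) = 0" using assms(1) by (simp add: ip_def)
  then have "\<forall>i\<in>{1..n}. x i * x i = 0"
    by (subst (asm) sum_nonneg_eq_0_iff) auto
  then show ?thesis using assms(2) by auto
qed

lemma ip_self_zero_left:
  assumes "ip n x x = 0"
  shows "ip n x y = 0"
  using ip_self_zero[OF assms] by (simp add: ip_def)

text \<open>
  Zero vectors are admitted, so that a Gram-Schmidt step always adds exactly one vector and is given
  by a single formula (the division by a vanishing norm gives \<open>0\<close>).
\<close>

definition subon :: "nat \<Rightarrow> nat \<Rightarrow> (nat \<Rightarrow> nat \<Rightarrow> real) \<Rightarrow> bool" where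
  "subon n r f \<longleftrightarrow> (\<forall>k<r. \<forall>l<r. k \<noteq> l \<longrightarrow> ip n (f k) (f l) = 0) \<and>
                 (\<forall>k<r. ip n (f k) (f k) \<in> {0, 1})"

definition proj :: "nat \<Rightarrow> nat \<Rightarrow> (nat \<Rightarrow> nat \<Rightarrow> real) \<Rightarrow> (nat \<Rightarrow> real) \<Rightarrow> nat \<Rightarrow> real" where
  "proj n r f w i = (\<Sum>l<r. ip n (f l) w * f l i)"

definition res :: "nat \<Rightarrow> nat \<Rightarrow> (nat \<Rightarrow> nat \<Rightarrow> real) \<Rightarrow> (nat \<Rightarrow> real) \<Rightarrow> nat \<Rightarrow> real" where
  "res n r f w i = w i - proj n r f w i"

text \<open>For a \<open>subon\<close> family this is membership in the linear span, read on the
  coordinates in \<open>{1..n}\<close>. As a fixed-point equation it is linear in \<open>w\<close>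
  and supplies the coordinates of \<open>w\<close> at once.\<close>

definition spans :: "nat \<Rightarrow> nat \<Rightarrow> (nat \<Rightarrow> nat \<Rightarrow> real) \<Rightarrow> (nat \<Rightarrow> real) \<Rightarrow> bool" where
  "spans n r f w \<longleftrightarrow> (\<forall>i\<in>{1..n}. w i = proj n r f w i)"

text \<open>For a \<open>subon\<close> family this is the squared distance of \<open>w\<close> to
  the span, by Pythagoras. Written without the residual it is visibly a quadratic form in
  \<open>w\<close>, as the exponential moments require.\<close>

definition sqd :: "nat \<Rightarrow> nat \<Rightarrow> (nat \<Rightarrow> nat \<Rightarrow> real) \<Rightarrow> (nat \<Rightarrow> real) \<Rightarrow> real" where
  "sqd n r f w = ip n w w - (\<Sum>l<r. (ip n (f l) w)\<^sup>2)"

lemma sqd_le: "sqd n r f w \<le> ip n w w"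
  by (simp add: sqd_def sum_nonneg)

text \<open>Either the squared norm is 1, or \<open>f k\<close> vanishes on \<open>{1..n}\<close>
  and both sides are 0. This makes zero vectors in the family harmless.\<close>

lemma subon_self_mult:
  assumes "subon n r f" "k < r"
  shows "ip n (f k) (f k) * ip n (f k) w = ip n (f k) w"
  using assms ip_self_zero_left[of n "f k" w] by (auto simp: subon_def)

lemma subon_sum:
  assumes "subon n r f" "k < r"
  shows "ip n (f k) (\<lambda>i. \<Sum>l<r. c l * f l i) = c k * ip n (f k) (f k)"
proof -
  have "ip n (f k) (\<lambda>i. \<Sum>l<r. c l * f l i) = (\<Sum>l<r. c l * ip n (f k) (f l))"
    by (simp add: ip_simps)
  also have "\<dots> = (\<Sum>l<r. if l = k then c k * ip n (f k) (f k) else 0)"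
    using assms by (intro sum.cong) (auto simp: subon_def)
  finally show ?thesis using assms(2) by simp
qed

lemma ip_proj:
  assumes "subon n r f" "k < r"
  shows "ip n (f k) (proj n r f w) = ip n (f k) w"
  using subon_sum[OF assms, of "\<lambda>l. ip n (f l) w"] subon_self_mult[OF assms, of w]
  by (simp add: proj_def[abs_def] mult.commute)

lemma ip_res:
  assumes "subon n r f" "k < r"
  shows "ip n (f k) (res n r f w) = 0"
  using ip_proj[OF assms] by (simp add: res_def[abs_def] ip_simps)

lemma ip_proj_left: "ip n (proj n r f w) x = (\<Sum>l<r. ip n (f l) w * ip n (f l) x)"
  by (simp add: proj_def[abs_def] ip_simps)

lemma ip_proj_res:
  assumes "subon n r f"
  shows "ip n (proj n r f w) (res n r f w') = 0"
  using ip_res[OF assms] by (simp add: ip_proj_left)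

lemma ip_res_res:
  assumes "subon n r f"
  shows "ip n (res n r f w) (res n r f w) = sqd n r f w"
proof -
  have "ip n (res n r f w) (res n r f w) = ip n w (res n r f w)"
    using ip_proj_res[OF assms, of w w]
    by (subst res_def[abs_def]) (simp add: ip_simps)
  also have "\<dots> = ip n w w - ip n (proj n r f w) w"
    by (simp add: res_def[abs_def] ip_simps ip_commute[of n w "proj n r f w"])
  finally show ?thesis by (simp add: ip_proj_left sqd_def power2_eq_square)
qed

lemma sqd_nonneg: "subon n r f \<Longrightarrow> 0 \<le> sqd n r f w"
  using ip_res_res ip_self_nonneg by metis

lemma spans_comb:
  assumes "spans n r f x" "spans n r f y"
  shows "spans n r f (\<lambda>i. c * x i + d * y i)"
  unfolding spans_def
proof
  fix i assume i: "i \<in> {1..n}"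
  have "proj n r f (\<lambda>i. c * x i + d * y i) i = c * proj n r f x i + d * proj n r f y i"
    by (simp add: proj_def ip_simps sum_distrib_left algebra_simps sum.distrib)
  then show "c * x i + d * y i = proj n r f (\<lambda>i. c * x i + d * y i) i"
    using assms i by (simp add: spans_def)
qed

lemma spans_zero: "spans n r f (\<lambda>i. 0)"
  by (simp add: spans_def proj_def ip_def)

lemma spans_lin:
  assumes "finite \<tau>" "\<And>j. j \<in> \<tau> \<Longrightarrow> spans n r f (\<lambda>i. X i j)"
  shows "spans n r f (lin X \<tau> \<beta>)"
  using assms
proof (induction \<tau> rule: finite_induct)
  case empty
  then show ?case using spans_zero by (simp add: lin_def[abs_def])
next
  case (insert j \<tau>)
  have "spans n r f (\<lambda>i. \<beta> j * X i j + 1 * lin X \<tau> \<beta> i)"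
    using insert by (intro spans_comb) auto
  moreover have "(\<lambda>i. \<beta> j * X i j + 1 * lin X \<tau> \<beta> i) = lin X (insert j \<tau>) \<beta>"
    using insert by (simp add: lin_def[abs_def] mult.commute)
  ultimately show ?case by simp
qed

text \<open>An element of the span drops out of the residual, and what remains scales with
  \<open>c\<close>.\<close>

lemma spans_sqd_add:
  assumes "subon n r f" "spans n r f x"
  shows "sqd n r f (\<lambda>i. c * y i + x i) = c\<^sup>2 * sqd n r f y"
proof -
  have "res n r f (\<lambda>i. c * y i + x i) i = c * res n r f y i" if "i \<in> {1..n}" for i
  proof -
    have "proj n r f (\<lambda>i. c * y i + x i) i = c * proj n r f y i + proj n r f x i"
      by (simp add: proj_def ip_simps sum_distrib_left algebra_simps sum.distrib)
    moreover have "x i = proj n r f x i" using assms(2) that by (simp add: spans_def)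
    ultimately show ?thesis by (simp add: res_def algebra_simps)
  qed
  then have "ip n (res n r f (\<lambda>i. c * y i + x i)) (res n r f (\<lambda>i. c * y i + x i))
     = ip n (\<lambda>i. c * res n r f y i) (\<lambda>i. c * res n r f y i)"
    by (intro ip_cong) auto
  then show ?thesis
    by (simp add: ip_res_res[OF assms(1)] ip_simps power2_eq_square)
qed

lemma spans_norm_ge:
  assumes "subon n r f" "spans n r f x"
  shows "c\<^sup>2 * sqd n r f y \<le> norm2_sq n (\<lambda>i. c * y i + x i)"
  using spans_sqd_add[OF assms, of c y] sqd_le[of n r f "\<lambda>i. c * y i + x i"]
  by (simp add: norm2_sq_ip)

lemma spans_ip:
  assumes "spans n r f w"
  shows "ip n w z = (\<Sum>l<r. ip n (f l) w * ip n (f l) z)"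
proof -
  have "ip n w z = ip n (proj n r f w) z"
    using assms by (intro ip_cong) (auto simp: spans_def)
  then show ?thesis by (simp add: ip_proj_left)
qed

text \<open>A refinement of \<open>spans_norm_ge\<close>: inside the span, Cauchy-Schwarz on the
  coordinates shows that the projected part is at least the component along the unit vector
  \<open>w\<close>.\<close>

lemma spans_norm_ge_direction:
  assumes "subon n r f" "spans n r f x" "spans n r f w" "ip n w w = 1"
  shows "(ip n w (\<lambda>i. c * y i + x i))\<^sup>2 + c\<^sup>2 * sqd n r f y
           \<le> norm2_sq n (\<lambda>i. c * y i + x i)"
proof -
  let ?z = "\<lambda>i. c * y i + x i"
  have "(ip n w ?z)\<^sup>2 = (\<Sum>l<r. ip n (f l) w * ip n (f l) ?z)\<^sup>2"
    by (simp only: spans_ip[OF assms(3)])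
  also have "\<dots> \<le> (\<Sum>l<r. (ip n (f l) w)\<^sup>2) * (\<Sum>l<r. (ip n (f l) ?z)\<^sup>2)"
    by (rule Cauchy_Schwarz_ineq_sum)
  also have "(\<Sum>l<r. (ip n (f l) w)\<^sup>2) = 1"
    using spans_ip[OF assms(3), of w] assms(4) by (simp add: power2_eq_square)
  finally have "(ip n w ?z)\<^sup>2 \<le> ip n ?z ?z - sqd n r f ?z" by (simp add: sqd_def)
  then show ?thesis
    using spans_sqd_add[OF assms(1,2), of c y] by (simp add: norm2_sq_ip)
qed

section \<open>Gram-Schmidt steps\<close>

definition gs_step :: "nat \<Rightarrow> nat \<Rightarrow> (nat \<Rightarrow> nat \<Rightarrow> real) \<Rightarrow> (nat \<Rightarrow> real) \<Rightarrow> nat \<Rightarrow> nat \<Rightarrow> real" where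
  "gs_step n r f w = f(r := (\<lambda>i. res n r f w i / sqrt (sqd n r f w)))"

lemma gs_step_old: "l < r \<Longrightarrow> gs_step n r f w l = f l"
  by (simp add: gs_step_def)

lemma gs_step_new: "gs_step n r f w r = (\<lambda>i. res n r f w i / sqrt (sqd n r f w))"
  by (simp add: gs_step_def)

lemma subon_gs_step:
  assumes "subon n r f"
  shows "subon n (Suc r) (gs_step n r f w)"
proof -
  let ?g = "gs_step n r f w"
  have orth: "ip n (?g k) (?g r) = 0" if "k < r" for k
    using ip_res[OF assms that] that by (simp add: gs_step_old gs_step_new ip_simps)
  have "ip n (?g r) (?g r) = sqd n r f w / (sqrt (sqd n r f w) * sqrt (sqd n r f w))"
    by (simp add: gs_step_new ip_simps ip_res_res[OF assms])
  then have self: "ip n (?g r) (?g r) \<in> {0, 1}"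
    using sqd_nonneg[OF assms, of w] by auto
  show ?thesis
    unfolding subon_def
  proof (intro conjI allI impI)
    fix k l assume kl: "k < Suc r" "l < Suc r" "k \<noteq> l"
    show "ip n (?g k) (?g l) = 0"
    proof (cases "k = r")
      case True then show ?thesis using kl orth[of l] by (simp add: ip_commute)
    next
      case False
      then show ?thesis using kl orth[of k] assms
        by (cases "l = r") (auto simp: gs_step_old subon_def)
    qed
  next
    fix k assume "k < Suc r"
    then show "ip n (?g k) (?g k) \<in> {0, 1}"
      using self assms by (cases "k = r") (auto simp: gs_step_old subon_def)
  qed
qed

lemma spans_gs_step_old:
  assumes "subon n r f" "spans n r f x"
  shows "spans n (Suc r) (gs_step n r f w) x"
proof -
  let ?g = "gs_step n r f w"
  have "ip n x (res n r f w) = 0"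
    using spans_ip[OF assms(2)] ip_res[OF assms(1)] by simp
  then have "ip n (?g r) x = 0"
    by (simp add: gs_step_new ip_simps ip_commute[of n x])
  moreover have "(\<Sum>l<r. ip n (?g l) x * ?g l i) = proj n r f x i" for i
    by (simp add: proj_def gs_step_old)
  ultimately show ?thesis
    using assms(2) by (simp add: spans_def proj_def[of n "Suc r"])
qed

lemma spans_gs_step_new:
  assumes "subon n r f"
  shows "spans n (Suc r) (gs_step n r f w) w"
  unfolding spans_def
proof
  let ?g = "gs_step n r f w" and ?s = "sqd n r f w"
  fix i assume i: "i \<in> {1..n}"
  have "ip n (res n r f w) w = ?s"
    using ip_proj_res[OF assms, of w w] ip_res_res[OF assms, of w]
      ip_add_right[of n "res n r f w" "res n r f w" "proj n r f w"]
    by (simp add: res_def ip_commute)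
  then have "ip n (?g r) w * ?g r i = ?s * res n r f w i / (sqrt ?s * sqrt ?s)"
    by (simp add: gs_step_new ip_simps)
  \<comment> \<open>If \<open>?s = 0\<close>, division by zero gives 0 on the left, and the residual
    itself vanishes on \<open>{1..n}\<close>.\<close>
  also have "\<dots> = res n r f w i"
    using sqd_nonneg[OF assms, of w] ip_self_zero[of n "res n r f w" i] i ip_res_res[OF assms, of w]
    by (cases "?s = 0") auto
  finally have "proj n (Suc r) ?g w i = proj n r f w i + res n r f w i"
    by (simp add: proj_def gs_step_old)
  then show "w i = proj n (Suc r) ?g w i" by (simp add: res_def)
qed

text \<open>The step subtracts projections one at a time and then rescales, so closure under
  \<open>x + c * y\<close> is all that is asked of \<open>S\<close>. It serves to locate basis
  vectors in a column space.\<close>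

lemma gs_step_mem:
  assumes S: "\<And>x y c. x \<in> S \<Longrightarrow> y \<in> S \<Longrightarrow> (\<lambda>i. x i + c * y i) \<in> S"
    and f: "\<And>l. l < r \<Longrightarrow> f l \<in> S" and w: "w \<in> S" and l: "l < Suc r"
  shows "gs_step n r f w l \<in> S"
proof -
  have partial: "(\<lambda>i. w i - (\<Sum>l<k. ip n (f l) w * f l i)) \<in> S" if "k \<le> r" for k
    using that
  proof (induction k)
    case 0 then show ?case using w by simp
  next
    case (Suc k)
    then show ?case
      using S[of "\<lambda>i. w i - (\<Sum>l<k. ip n (f l) w * f l i)" "f k" "- ip n (f k) w"] f
      by (simp add: algebra_simps)
  qed
  then have resS: "res n r f w \<in> S"
    by (simp add: res_def[abs_def] proj_def)
  \<comment> \<open>Scaling by \<open>c\<close> is written as \<open>x + (c - 1) * x\<close> to fit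
    the closure hypothesis.\<close>
  have "(\<lambda>i. c * res n r f w i) \<in> S" for c
    using S[OF resS resS, of "c - 1"] by (simp add: algebra_simps)
  from this[of "1 / sqrt (sqd n r f w)"] have "gs_step n r f w r \<in> S" by (simp add: gs_step_new)
  then show ?thesis using l f by (cases "l = r") (auto simp: gs_step_old)
qed

text \<open>One Gram-Schmidt step per column, leaving the first \<open>r\<close> vectors in place. A
  dependent column contributes a zero vector, so the length is \<open>r + card \<tau>\<close>
  whatever the rank.\<close>

lemma gs_extend:
  assumes "finite \<tau>" "subon n r f"
    and S: "\<And>x y c. x \<in> S \<Longrightarrow> y \<in> S \<Longrightarrow> (\<lambda>i. x i + c * y i) \<in> S"
    and "\<And>l. l < r \<Longrightarrow> f l \<in> S" "\<And>j. j \<in> \<tau> \<Longrightarrow> (\<lambda>i. X i j) \<in> S"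
  shows "\<exists>g. subon n (r + card \<tau>) g \<and> (\<forall>l<r. g l = f l) \<and> (\<forall>l<r + card \<tau>. g l \<in> S) \<and>
           (\<forall>x. spans n r f x \<longrightarrow> spans n (r + card \<tau>) g x) \<and>
           (\<forall>j\<in>\<tau>. spans n (r + card \<tau>) g (\<lambda>i. X i j))"
  using assms(1,5)
proof (induction \<tau> rule: finite_induct)
  case empty
  then show ?case using assms by (intro exI[of _ f]) auto
next
  case (insert j \<tau>)
  then obtain g where g: "subon n (r + card \<tau>) g" "\<forall>l<r. g l = f l" "\<forall>l<r + card \<tau>. g l \<in> S"
    "\<forall>x. spans n r f x \<longrightarrow> spans n (r + card \<tau>) g x" "\<forall>j\<in>\<tau>. spans n (r + card \<tau>) g (\<lambda>i. X i j)"
    by auto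
  let ?R = "r + card \<tau>" and ?w = "\<lambda>i. X i j"
  let ?h = "gs_step n ?R g ?w"
  have "?h l \<in> S" if "l < Suc ?R" for l
  proof (rule gs_step_mem[of S])
    show "g l \<in> S" if "l < ?R" for l using g(3) that by blast
    show "?w \<in> S" using insert.prems by blast
  qed (fact S that)+
  moreover have "\<forall>l<r. ?h l = f l" using g(2) by (simp add: gs_step_old)
  ultimately show ?case
    using subon_gs_step[OF g(1), of ?w] spans_gs_step_old[OF g(1), of _ ?w]
      spans_gs_step_new[OF g(1), of ?w] g(4,5) insert.hyps
    by (intro exI[of _ ?h]) auto
qed

section \<open>Exponential moments of Gaussian quadratic forms\<close>

text \<open>Completing the square turns the density times the integrand into a constant multiple of
  the normal density with mean \<open>w / c\<close> and variance \<open>1 / c\<close>, where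
  \<open>c = 1 + 2 * a\<close>.\<close>

lemma nn_integral_std_normal_exp_quad:
  assumes "0 < 1 + 2 * a"
  shows "(\<integral>\<^sup>+x. ennreal (exp (- a * x\<^sup>2 + w * x)) \<partial>std_normal_distribution)
           = ennreal (exp (w\<^sup>2 / (2 * (1 + 2 * a))) / sqrt (1 + 2 * a))"
proof -
  define c where "c = 1 + 2 * a"
  have c: "0 < c" using assms by (simp add: c_def)
  define K where "K = exp (w\<^sup>2 / (2 * c)) / sqrt c"
  have K: "0 \<le> K" using c by (simp add: K_def)
  have *: "std_normal_density x * exp (- a * x\<^sup>2 + w * x) = K * normal_density (w / c) (1 / sqrt c) x" for x
  proof -
    have e: "- x\<^sup>2 / 2 + (- a * x\<^sup>2 + w * x)
        = w\<^sup>2 / (2 * c) + (-(x - w / c)\<^sup>2 / (2 * (1 / sqrt c)\<^sup>2))"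
    proof -
      have a: "a = (c - 1) / 2" by (simp add: c_def)
      show ?thesis unfolding a using c by (simp add: power_divide field_simps power2_eq_square)
    qed
    have "sqrt (2 * pi * (1 / sqrt c)\<^sup>2) = sqrt (2 * pi) / sqrt c"
      using c by (simp add: power_divide real_sqrt_divide real_sqrt_mult)
    then have "K * normal_density (w / c) (1 / sqrt c) x
        = 1 / sqrt (2 * pi) * exp (w\<^sup>2 / (2 * c) + (-(x - w / c)\<^sup>2 / (2 * (1 / sqrt c)\<^sup>2)))"
      using c unfolding K_def normal_density_def by (simp add: mult_exp_exp)
    also have "\<dots> = std_normal_density x * exp (- a * x\<^sup>2 + w * x)"
      unfolding e[symmetric] std_normal_density_def by (simp add: mult_exp_exp)
    finally show ?thesis by simp
  qed
  have "(\<integral>\<^sup>+x. ennreal (exp (- a * x\<^sup>2 + w * x)) \<partial>std_normal_distribution)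
      = (\<integral>\<^sup>+x. ennreal (std_normal_density x) * ennreal (exp (- a * x\<^sup>2 + w * x)) \<partial>lborel)"
    by (rule nn_integral_density) auto
  also have "\<dots> = (\<integral>\<^sup>+x. ennreal K * ennreal (normal_density (w / c) (1 / sqrt c) x) \<partial>lborel)"
    using K by (intro nn_integral_cong) (simp only: ennreal_mult[symmetric] normal_density_nonneg * exp_ge_zero)
  also have "\<dots> = ennreal K * (\<integral>\<^sup>+x. ennreal (normal_density (w / c) (1 / sqrt c) x) \<partial>lborel)"
    by (rule nn_integral_cmult) auto
  also have "(\<integral>\<^sup>+x. ennreal (normal_density (w / c) (1 / sqrt c) x) \<partial>lborel) = 1"
    using prob_space.emeasure_space_1[OF prob_space_normal_density[of "1 / sqrt c" "w / c"]] c
    by (simp add: emeasure_density)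
  finally show ?thesis by (simp add: K_def c_def)
qed

interpretation gauss: product_sigma_finite "\<lambda>_ :: nat. std_normal_distribution"
  by (intro product_sigma_finite.intro prob_space_imp_sigma_finite prob_space_normal_density) simp

lemma prob_space_std_normal_vec: "prob_space (std_normal_vec n)"
  unfolding std_normal_vec_def by (intro prob_space_PiM prob_space_normal_density) simp

lemma measurable_std_normal_vec_component:
  "i \<in> {1..n} \<Longrightarrow> (\<lambda>x. x i) \<in> borel_measurable (std_normal_vec n)"
  using measurable_component_singleton[of i "{1..n}" "\<lambda>_. std_normal_distribution"]
  by (simp add: std_normal_vec_def cong: measurable_cong_sets)

lemma measurable_ip [measurable (raw)]:
  assumes "\<And>i. i \<in> {1..n} \<Longrightarrow> (\<lambda>z. x z i) \<in> borel_measurable M"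
    and "\<And>i. i \<in> {1..n} \<Longrightarrow> (\<lambda>z. y z i) \<in> borel_measurable M"
  shows "(\<lambda>z. ip n (x z) (y z)) \<in> borel_measurable M"
  unfolding ip_def using assms by (intro borel_measurable_sum borel_measurable_times) auto

lemma nn_integral_std_normal_vec_exp_quad:
  assumes "0 < 1 + 2 * a"
  shows "(\<integral>\<^sup>+x. ennreal (exp (- a * ip n x x + ip n w x)) \<partial>std_normal_vec n)
           = ennreal (exp (ip n w w / (2 * (1 + 2 * a))) / sqrt (1 + 2 * a) ^ n)"
proof -
  have "(\<integral>\<^sup>+x. ennreal (exp (- a * ip n x x + ip n w x)) \<partial>std_normal_vec n)
      = (\<integral>\<^sup>+x. (\<Prod>i\<in>{1..n}. ennreal (exp (- a * (x i)\<^sup>2 + w i * x i))) \<partial>std_normal_vec n)"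
    by (intro nn_integral_cong)
      (simp add: ip_def prod_ennreal exp_sum[symmetric] sum_distrib_left sum.distrib[symmetric]
        power2_eq_square mult.assoc flip: sum_negf)
  also have "\<dots> = (\<Prod>i\<in>{1..n}. \<integral>\<^sup>+x. ennreal (exp (- a * x\<^sup>2 + w i * x)) \<partial>std_normal_distribution)"
    unfolding std_normal_vec_def by (rule gauss.product_nn_integral_prod) auto
  also have "\<dots> = (\<Prod>i\<in>{1..n}. ennreal (exp ((w i)\<^sup>2 / (2 * (1 + 2 * a))) / sqrt (1 + 2 * a)))"
    by (simp only: nn_integral_std_normal_exp_quad[OF assms])
  also have "\<dots> = ennreal (\<Prod>i\<in>{1..n}. exp ((w i)\<^sup>2 / (2 * (1 + 2 * a))) / sqrt (1 + 2 * a))"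
    using assms by (intro prod_ennreal) auto
  also have "(\<Prod>i\<in>{1..n}. exp ((w i)\<^sup>2 / (2 * (1 + 2 * a))) / sqrt (1 + 2 * a))
      = exp (ip n w w / (2 * (1 + 2 * a))) / sqrt (1 + 2 * a) ^ n"
    by (simp add: prod_dividef exp_sum[symmetric] ip_def sum_divide_distrib power2_eq_square)
  finally show ?thesis .
qed

text \<open>
  The Hubbard-Stratonovich identity \<open>exp (b z\<^sup>2) = E exp (sqrt (2 b) z G)\<close> with \<open>G\<close> standard normal
  linearises the quadratic terms, so that rotation invariance of the Gaussian law is not needed.
\<close>

lemma nn_integral_std_normal_vec_exp_forms:
  assumes f: "subon n r f" and a: "0 < 1 + 2 * a"
    and b: "\<And>l. l < r \<Longrightarrow> 0 \<le> b l" "\<And>l. l < r \<Longrightarrow> 2 * b l < 1 + 2 * a"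
  shows "(\<integral>\<^sup>+x. ennreal (exp (- a * ip n x x + (\<Sum>l<r. b l * (ip n (f l) x)\<^sup>2))) \<partial>std_normal_vec n)
           \<le> ennreal ((\<Prod>l<r. 1 / sqrt (1 - 2 * b l / (1 + 2 * a))) / sqrt (1 + 2 * a) ^ n)"
proof -
  let ?N = "std_normal_distribution"
  let ?G = "\<Pi>\<^sub>M l\<in>{..<r}. ?N"
  define c where "c = 1 + 2 * a"
  have c: "0 < c" using a by (simp add: c_def)
  let ?W = "\<lambda>g i. \<Sum>l<r. (sqrt (2 * b l) * g l) * f l i"
  have lin: "ip n (?W g) x = (\<Sum>l<r. sqrt (2 * b l) * ip n (f l) x * g l)" for g x
    unfolding ip_sum_left ip_scale_left by (intro sum.cong refl) (simp add: mult_ac)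
  have one: "ennreal (exp (b l * z\<^sup>2)) = (\<integral>\<^sup>+g. ennreal (exp (sqrt (2 * b l) * z * g)) \<partial>?N)"
    if "l < r" for l z
    using nn_integral_std_normal_exp_quad[of 0 "sqrt (2 * b l) * z"] b(1)[OF that]
    by (simp add: power_mult_distrib)
  have hs: "ennreal (exp (- a * ip n x x + (\<Sum>l<r. b l * (ip n (f l) x)\<^sup>2)))
      = (\<integral>\<^sup>+g. ennreal (exp (- a * ip n x x + ip n (?W g) x)) \<partial>?G)" for x
  proof -
    have "ennreal (exp (- a * ip n x x + (\<Sum>l<r. b l * (ip n (f l) x)\<^sup>2)))
       = ennreal (exp (- a * ip n x x)) * (\<Prod>l<r. ennreal (exp (b l * (ip n (f l) x)\<^sup>2)))"
      by (subst exp_add) (simp add: exp_sum ennreal_mult prod_ennreal prod_nonneg)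
    also have "(\<Prod>l<r. ennreal (exp (b l * (ip n (f l) x)\<^sup>2)))
       = (\<Prod>l<r. \<integral>\<^sup>+g. ennreal (exp (sqrt (2 * b l) * ip n (f l) x * g)) \<partial>?N)"
      by (intro prod.cong one) auto
    also have "\<dots> = (\<integral>\<^sup>+g. (\<Prod>l<r. ennreal (exp (sqrt (2 * b l) * ip n (f l) x * g l))) \<partial>?G)"
      by (rule gauss.product_nn_integral_prod[symmetric]) auto
    also have "ennreal (exp (- a * ip n x x)) * \<dots>
       = (\<integral>\<^sup>+g. ennreal (exp (- a * ip n x x))
             * (\<Prod>l<r. ennreal (exp (sqrt (2 * b l) * ip n (f l) x * g l))) \<partial>?G)"
      by (rule nn_integral_cmult[symmetric]) measurable
    also have "\<dots> = (\<integral>\<^sup>+g. ennreal (exp (- a * ip n x x + ip n (?W g) x)) \<partial>?G)"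
      unfolding lin by (subst exp_add) (simp add: exp_sum ennreal_mult prod_ennreal prod_nonneg)
    finally show ?thesis .
  qed
  interpret V: prob_space "std_normal_vec n" by (rule prob_space_std_normal_vec)
  interpret G: prob_space ?G by (intro prob_space_PiM prob_space_normal_density) simp
  interpret P: pair_sigma_finite "std_normal_vec n" ?G ..
  \<comment> \<open>Equality would hold for an orthonormal family; zero vectors only lower the norm.
    This is the source of the inequality in the lemma.\<close>
  have WW: "ip n (?W g) (?W g) \<le> (\<Sum>l<r. 2 * b l * (g l)\<^sup>2)" for g
  proof -
    have "ip n (?W g) (?W g) = (\<Sum>k<r. (sqrt (2 * b k) * g k) * ip n (f k) (?W g))"
      by (subst ip_sum_left) (simp add: ip_scale_left)
    also have "\<dots> = (\<Sum>k<r. (sqrt (2 * b k) * g k) * ((sqrt (2 * b k) * g k) * ip n (f k) (f k)))"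
      by (intro sum.cong refl) (simp only: subon_sum[OF f] lessThan_iff)
    also have "\<dots> \<le> (\<Sum>k<r. (sqrt (2 * b k) * g k)\<^sup>2)"
      using f by (intro sum_mono) (auto simp: subon_def power2_eq_square)
    also have "\<dots> = (\<Sum>l<r. 2 * b l * (g l)\<^sup>2)"
      using b(1) by (intro sum.cong) (auto simp: power_mult_distrib)
    finally show ?thesis .
  qed
  have "(\<integral>\<^sup>+x. ennreal (exp (- a * ip n x x + (\<Sum>l<r. b l * (ip n (f l) x)\<^sup>2))) \<partial>std_normal_vec n)
     = (\<integral>\<^sup>+x. \<integral>\<^sup>+g. ennreal (exp (- a * ip n x x + ip n (?W g) x)) \<partial>?G \<partial>std_normal_vec n)"
    by (simp only: hs)
  \<comment> \<open>Tonelli: for fixed auxiliary Gaussians \<open>g\<close>, the exponent in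
    \<open>x\<close> is a linear form plus a multiple of the squared norm, whose exponential moment
    is known.\<close>
  also have "\<dots> = (\<integral>\<^sup>+g. \<integral>\<^sup>+x. ennreal (exp (- a * ip n x x + ip n (?W g) x)) \<partial>std_normal_vec n \<partial>?G)"
    by (rule P.Fubini'[symmetric]) (unfold std_normal_vec_def, measurable)
  also have "\<dots> = (\<integral>\<^sup>+g. ennreal (exp (ip n (?W g) (?W g) / (2 * c)) / sqrt c ^ n) \<partial>?G)"
    by (simp only: nn_integral_std_normal_vec_exp_quad[OF a] c_def)
  also have "\<dots> \<le> (\<integral>\<^sup>+g. ennreal (1 / sqrt c ^ n)
                      * (\<Prod>l<r. ennreal (exp (- (- b l / c) * (g l)\<^sup>2 + 0 * g l))) \<partial>?G)"
  proof (rule nn_integral_mono)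
    fix g
    have "ip n (?W g) (?W g) / (2 * c) \<le> (\<Sum>l<r. 2 * b l * (g l)\<^sup>2) / (2 * c)"
      using WW c by (intro divide_right_mono) auto
    also have "\<dots> = (\<Sum>l<r. - (- b l / c) * (g l)\<^sup>2 + 0 * g l)"
      by (simp add: sum_divide_distrib)
    finally have "exp (ip n (?W g) (?W g) / (2 * c)) / sqrt c ^ n
       \<le> (\<Prod>l<r. exp (- (- b l / c) * (g l)\<^sup>2 + 0 * g l)) / sqrt c ^ n"
      unfolding exp_sum[OF finite_lessThan, symmetric] using c by (intro divide_right_mono) auto
    also have "\<dots> = 1 / sqrt c ^ n * (\<Prod>l<r. exp (- (- b l / c) * (g l)\<^sup>2 + 0 * g l))"
      by simp
    finally show "ennreal (exp (ip n (?W g) (?W g) / (2 * c)) / sqrt c ^ n)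
       \<le> ennreal (1 / sqrt c ^ n) * (\<Prod>l<r. ennreal (exp (- (- b l / c) * (g l)\<^sup>2 + 0 * g l)))"
      using c by (subst prod_ennreal) (auto simp: ennreal_mult[symmetric] prod_nonneg ennreal_leI)
  qed
  also have "\<dots> = ennreal (1 / sqrt c ^ n)
      * (\<integral>\<^sup>+g. (\<Prod>l<r. ennreal (exp (- (- b l / c) * (g l)\<^sup>2 + 0 * g l))) \<partial>?G)"
    by (rule nn_integral_cmult) measurable
  also have "(\<integral>\<^sup>+g. (\<Prod>l<r. ennreal (exp (- (- b l / c) * (g l)\<^sup>2 + 0 * g l))) \<partial>?G)
      = (\<Prod>l<r. \<integral>\<^sup>+g. ennreal (exp (- (- b l / c) * g\<^sup>2 + 0 * g)) \<partial>?N)"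
    by (rule gauss.product_nn_integral_prod) auto
  also have "\<dots> = (\<Prod>l<r. ennreal (1 / sqrt (1 - 2 * b l / c)))"
  proof (intro prod.cong refl)
    fix l assume "l \<in> {..<r}"
    \<comment> \<open>The condition \<open>2 * b l < 1 + 2 * a\<close> is what makes this Gaussian
      integral finite.\<close>
    then have "0 < 1 + 2 * (- b l / c)" using b(2)[of l] c by (simp add: c_def field_simps)
    from nn_integral_std_normal_exp_quad[OF this, of 0]
    show "(\<integral>\<^sup>+g. ennreal (exp (- (- b l / c) * g\<^sup>2 + 0 * g)) \<partial>?N) = ennreal (1 / sqrt (1 - 2 * b l / c))"
      by simp
  qed
  also have "\<dots> = ennreal (\<Prod>l<r. 1 / sqrt (1 - 2 * b l / c))"
    using b(2) c by (intro prod_ennreal) (auto simp: c_def field_simps intro!: less_imp_le)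
  also have "ennreal (1 / sqrt c ^ n) * \<dots> = ennreal ((\<Prod>l<r. 1 / sqrt (1 - 2 * b l / c)) / sqrt c ^ n)"
    using c by (simp add: ennreal_mult'[symmetric])
  finally show ?thesis by (simp add: c_def)
qed

section \<open>The model selection criterion\<close>

lemma lin_add_scale: "(\<lambda>i. lin X \<tau> \<beta> i + c * lin X \<tau> \<beta>' i) = lin X \<tau> (\<lambda>j. \<beta> j + c * \<beta>' j)"
  by (rule ext) (simp add: lin_def sum_distrib_left sum.distrib distrib_left mult.left_commute)

lemma lin_single: "finite \<tau> \<Longrightarrow> j \<in> \<tau> \<Longrightarrow> lin X \<tau> (\<lambda>k. if k = j then 1 else 0) = (\<lambda>i. X i j)"
  by (rule ext) (simp add: lin_def if_distrib cong: if_cong)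

section \<open>Bases of the column space of a model, without and with a noise vector\<close>

lemma model_basis_exists:
  assumes "finite \<tau>"
  shows "\<exists>h. subon n (card \<tau>) h \<and> (\<forall>l<card \<tau>. h l \<in> range (lin X \<tau>)) \<and>
             (\<forall>j\<in>\<tau>. spans n (card \<tau>) h (\<lambda>i. X i j))"
proof -
  have "\<exists>g. subon n (0 + card \<tau>) g \<and> (\<forall>l<0. g l = (\<lambda>_. 0)) \<and>
           (\<forall>l<0 + card \<tau>. g l \<in> range (lin X \<tau>)) \<and>
           (\<forall>x. spans n 0 (\<lambda>_ _. 0) x \<longrightarrow> spans n (0 + card \<tau>) g x) \<and>
           (\<forall>j\<in>\<tau>. spans n (0 + card \<tau>) g (\<lambda>i. X i j))"
  proof (rule gs_extend)
    show "finite \<tau>" by fact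
    show "subon n 0 (\<lambda>_ _. 0)" by (simp add: subon_def)
    show "(\<lambda>i. x i + c * y i) \<in> range (lin X \<tau>)"
      if xy: "x \<in> range (lin X \<tau>)" "y \<in> range (lin X \<tau>)" for x y c
    proof -
      obtain \<beta> \<beta>' where "x = lin X \<tau> \<beta>" "y = lin X \<tau> \<beta>'" using xy by blast
      then show ?thesis by (simp only: lin_add_scale rangeI)
    qed
    show "(\<lambda>i. X i j) \<in> range (lin X \<tau>)" if "j \<in> \<tau>" for j
      unfolding lin_single[OF assms that, symmetric] by (rule rangeI)
  qed simp
  then obtain g where "subon n (card \<tau>) g" "\<forall>l<card \<tau>. g l \<in> range (lin X \<tau>)"
    "\<forall>j\<in>\<tau>. spans n (card \<tau>) g (\<lambda>i. X i j)" unfolding add_0 by (elim exE conjE)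
  then show ?thesis by blast
qed
text \<open>The choice depends on the columns only and not on any noise, so expressions built from
  it stay measurable in the noise.\<close>

definition model_basis :: "nat \<Rightarrow> (nat \<Rightarrow> nat \<Rightarrow> real) \<Rightarrow> nat set \<Rightarrow> nat \<Rightarrow> nat \<Rightarrow> real" where
  "model_basis n X \<tau> = (SOME h. subon n (card \<tau>) h \<and> (\<forall>l<card \<tau>. h l \<in> range (lin X \<tau>)) \<and>
             (\<forall>j\<in>\<tau>. spans n (card \<tau>) h (\<lambda>i. X i j)))"

lemma model_basis:
  assumes "finite \<tau>"
  shows subon_model_basis: "subon n (card \<tau>) (model_basis n X \<tau>)"
    and model_basis_mem: "l < card \<tau> \<Longrightarrow> \<exists>\<beta>. model_basis n X \<tau> l = lin X \<tau> \<beta>"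
    and spans_model_basis: "j \<in> \<tau> \<Longrightarrow> spans n (card \<tau>) (model_basis n X \<tau>) (\<lambda>i. X i j)"
  using someI_ex[OF model_basis_exists[OF assms, of n X], folded model_basis_def]
  by (blast+)

text \<open>The noise is appended last and by an explicit step rather than by choice: the dependence
  on \<open>u\<close> is a formula, from which measurability in \<open>u\<close> can be read
  off.\<close>

definition aug_basis ::
    "nat \<Rightarrow> (nat \<Rightarrow> nat \<Rightarrow> real) \<Rightarrow> nat set \<Rightarrow> (nat \<Rightarrow> real) \<Rightarrow> nat \<Rightarrow> nat \<Rightarrow> real" where
  "aug_basis n X \<tau> u = gs_step n (card \<tau>) (model_basis n X \<tau>) u"

lemma aug_basis:
  assumes "finite \<tau>"
  shows subon_aug_basis: "subon n (Suc (card \<tau>)) (aug_basis n X \<tau> u)"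
    and spans_aug_basis: "j \<in> \<tau> \<Longrightarrow> spans n (Suc (card \<tau>)) (aug_basis n X \<tau> u) (\<lambda>i. X i j)"
    and spans_aug_basis_noise: "spans n (Suc (card \<tau>)) (aug_basis n X \<tau> u) u"
  unfolding aug_basis_def
  by (rule subon_gs_step[OF subon_model_basis[OF assms]],
      erule spans_gs_step_old[OF subon_model_basis[OF assms] spans_model_basis[OF assms]],
      rule spans_gs_step_new[OF subon_model_basis[OF assms]])

lemma aug_basis_mem:
  assumes "finite \<tau>" "l < Suc (card \<tau>)"
  shows "\<exists>\<beta> \<sigma>. aug_basis n X \<tau> u l = (\<lambda>i. lin X \<tau> \<beta> i + \<sigma> * u i)"
proof -
  let ?S = "{x. \<exists>\<beta> \<sigma>. x = (\<lambda>i. lin X \<tau> \<beta> i + \<sigma> * u i)}"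
  have "aug_basis n X \<tau> u l \<in> ?S"
    unfolding aug_basis_def
  proof (rule gs_step_mem)
    fix x y c assume "x \<in> ?S" "y \<in> ?S"
    then obtain \<beta> \<sigma> \<beta>' \<sigma>' where
      "x = (\<lambda>i. lin X \<tau> \<beta> i + \<sigma> * u i)" "y = (\<lambda>i. lin X \<tau> \<beta>' i + \<sigma>' * u i)" by auto
    then have "(\<lambda>i. x i + c * y i)
        = (\<lambda>i. lin X \<tau> (\<lambda>j. \<beta> j + c * \<beta>' j) i + (\<sigma> + c * \<sigma>') * u i)"
      unfolding lin_add_scale[symmetric] by (simp add: algebra_simps)
    then show "(\<lambda>i. x i + c * y i) \<in> ?S" by blast
  next
    fix l assume "l < card \<tau>"
    then obtain \<beta> where "model_basis n X \<tau> l = lin X \<tau> \<beta>"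
      using model_basis_mem[OF assms(1)] by blast
    then have "model_basis n X \<tau> l = (\<lambda>i. lin X \<tau> \<beta> i + 0 * u i)" by simp
    then show "model_basis n X \<tau> l \<in> ?S" by blast
  next
    have "u = (\<lambda>i. lin X \<tau> (\<lambda>_. 0) i + 1 * u i)" by (simp add: lin_def)
    then show "u \<in> ?S" by blast
  qed (fact assms(2))
  then show ?thesis by simp
qed

section \<open>Closed form and measurability of the criterion\<close>

lemma lin_comb_sum:
  "(\<Sum>l\<in>L. c l * lin X \<tau> (\<beta> l) i) = lin X \<tau> (\<lambda>j. \<Sum>l\<in>L. c l * \<beta> l j) i"
proof -
  have "(\<Sum>l\<in>L. c l * lin X \<tau> (\<beta> l) i) = (\<Sum>l\<in>L. \<Sum>j\<in>\<tau>. X i j * (c l * \<beta> l j))"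
    by (simp add: lin_def sum_distrib_left mult_ac)
  also have "\<dots> = (\<Sum>j\<in>\<tau>. \<Sum>l\<in>L. X i j * (c l * \<beta> l j))" by (rule sum.swap)
  finally show ?thesis by (simp add: lin_def sum_distrib_left)
qed

lemma criterion_ge:
  assumes "\<And>\<beta> \<sigma>. B \<le> norm2_sq n (\<lambda>i. y i - lin X \<tau> \<beta> i - \<sigma> * u i)"
  shows "B + lam * real (card \<tau>) \<le> criterion n X lam y u \<tau>"
  unfolding criterion_def using assms by (intro cINF_greatest) auto

lemma criterion_le:
  "criterion n X lam y u \<tau> \<le> norm2_sq n (\<lambda>i. y i - lin X \<tau> \<beta> i - \<sigma> * u i) + lam * real (card \<tau>)"
proof -
  have "bdd_below (range (\<lambda>(\<beta>, \<sigma>). norm2_sq n (\<lambda>i. y i - lin X \<tau> \<beta> i - \<sigma> * u i) + lam * real (card \<tau>)))"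
    by (intro bdd_belowI[of _ "lam * real (card \<tau>)"]) (auto simp: norm2_sq_def)
  from cINF_lower[OF this, of "(\<beta>, \<sigma>)"] show ?thesis by (simp add: criterion_def)
qed

text \<open>Every basis vector is a combination of the columns and the noise, hence so is the
  projection. Its coefficients are the minimisers in the criterion.\<close>

lemma aug_basis_proj:
  assumes "finite \<tau>"
  shows "\<exists>\<beta> \<sigma>. proj n (Suc (card \<tau>)) (aug_basis n X \<tau> u) y = (\<lambda>i. lin X \<tau> \<beta> i + \<sigma> * u i)"
proof -
  let ?r = "Suc (card \<tau>)" and ?f = "aug_basis n X \<tau> u"
  have "\<forall>l\<in>{..<?r}. \<exists>\<beta> \<sigma>. ?f l = (\<lambda>i. lin X \<tau> \<beta> i + \<sigma> * u i)"
    using aug_basis_mem[OF assms, of _ n X u] by simp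
  from bchoice[OF this] obtain \<beta> where
    "\<forall>l\<in>{..<?r}. \<exists>\<sigma>. ?f l = (\<lambda>i. lin X \<tau> (\<beta> l) i + \<sigma> * u i)" by (elim exE)
  from bchoice[OF this] obtain \<sigma> where
    "\<forall>l\<in>{..<?r}. ?f l = (\<lambda>i. lin X \<tau> (\<beta> l) i + \<sigma> l * u i)" by (elim exE)
  then have \<beta>\<sigma>: "\<And>l. l < ?r \<Longrightarrow> ?f l = (\<lambda>i. lin X \<tau> (\<beta> l) i + \<sigma> l * u i)" by simp
  define \<beta>' where "\<beta>' j = (\<Sum>l<?r. ip n (?f l) y * \<beta> l j)" for j
  define \<sigma>' where "\<sigma>' = (\<Sum>l<?r. ip n (?f l) y * \<sigma> l)"
  have "proj n ?r ?f y i = lin X \<tau> \<beta>' i + \<sigma>' * u i" for i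
  proof -
    have "proj n ?r ?f y i = (\<Sum>l<?r. ip n (?f l) y * (lin X \<tau> (\<beta> l) i + \<sigma> l * u i))"
      unfolding proj_def by (intro sum.cong refl) (simp only: \<beta>\<sigma> lessThan_iff)
    also have "\<dots> = (\<Sum>l<?r. ip n (?f l) y * lin X \<tau> (\<beta> l) i) + (\<Sum>l<?r. ip n (?f l) y * \<sigma> l) * u i"
      by (simp only: distrib_left sum.distrib sum_distrib_right mult.assoc)
    finally show ?thesis unfolding lin_comb_sum \<beta>'_def \<sigma>'_def by simp
  qed
  then show ?thesis by blast
qed

text \<open>The projection of \<open>y\<close> attains the infimum, and \<open>spans_norm_ge\<close>
  shows that no other coefficients do better.\<close>

lemma criterion_eq:
  assumes fin: "finite \<tau>"
  shows "criterion n X lam y u \<tau> = sqd n (Suc (card \<tau>)) (aug_basis n X \<tau> u) y + lam * real (card \<tau>)"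
proof (rule antisym)
  let ?r = "Suc (card \<tau>)" and ?f = "aug_basis n X \<tau> u"
  obtain \<beta> \<sigma> where \<beta>\<sigma>: "proj n ?r ?f y = (\<lambda>i. lin X \<tau> \<beta> i + \<sigma> * u i)"
    using aug_basis_proj[OF fin] by blast
  have "(\<lambda>i. y i - lin X \<tau> \<beta> i - \<sigma> * u i) = res n ?r ?f y"
    by (simp add: res_def[abs_def] \<beta>\<sigma> algebra_simps)
  then have "norm2_sq n (\<lambda>i. y i - lin X \<tau> \<beta> i - \<sigma> * u i) = sqd n ?r ?f y"
    by (simp only: norm2_sq_ip ip_res_res[OF subon_aug_basis[OF fin]])
  then show "criterion n X lam y u \<tau> \<le> sqd n ?r ?f y + lam * real (card \<tau>)"
    using criterion_le[of n X lam y u \<tau> \<beta> \<sigma>] by simp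
next
  show "sqd n (Suc (card \<tau>)) (aug_basis n X \<tau> u) y + lam * real (card \<tau>) \<le> criterion n X lam y u \<tau>"
  proof (rule criterion_ge)
    fix \<beta> \<sigma>
    have "spans n (Suc (card \<tau>)) (aug_basis n X \<tau> u) (\<lambda>i. - 1 * lin X \<tau> \<beta> i + - \<sigma> * u i)"
      by (intro spans_comb spans_lin spans_aug_basis spans_aug_basis_noise fin)
    from spans_norm_ge[OF subon_aug_basis[OF fin] this, of 1 y]
    show "sqd n (Suc (card \<tau>)) (aug_basis n X \<tau> u) y \<le> norm2_sq n (\<lambda>i. y i - lin X \<tau> \<beta> i - \<sigma> * u i)"
      by (simp add: algebra_simps)
  qed
qed

text \<open>In the closed form only the last basis vector depends on \<open>u\<close>, and only
  through inner products, a square root and a quotient.\<close>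

lemma measurable_criterion:
  assumes fin: "finite \<tau>"
    and [measurable]: "\<And>i. i \<in> {1..n} \<Longrightarrow> (\<lambda>z. y z i) \<in> borel_measurable M"
      "\<And>i. i \<in> {1..n} \<Longrightarrow> (\<lambda>z. u z i) \<in> borel_measurable M"
  shows "(\<lambda>z. criterion n X lam (y z) (u z) \<tau>) \<in> borel_measurable M"
proof -
  let ?k = "card \<tau>" and ?h = "model_basis n X \<tau>"
  have "sqd n (Suc ?k) (aug_basis n X \<tau> u) y
      = ip n y y - (\<Sum>l<?k. (ip n (?h l) y)\<^sup>2)
        - (ip n (\<lambda>i. u i - (\<Sum>l<?k. ip n (?h l) u * ?h l i)) y
           / sqrt (ip n u u - (\<Sum>l<?k. (ip n (?h l) u)\<^sup>2)))\<^sup>2" for y u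
    unfolding sqd_def[of n "Suc ?k"] aug_basis_def
    by (simp add: gs_step_old gs_step_new ip_divide_left sqd_def res_def[abs_def] proj_def)
  then show ?thesis unfolding criterion_eq[OF fin] by simp
qed

lemma C_min_le:
  assumes n: "0 < n" and \<tau>\<^sub>0: "\<tau>\<^sub>0 \<subseteq> {1..p}" and \<tau>: "\<tau> \<subseteq> {1..p}" "\<tau> \<noteq> \<tau>\<^sub>0" "card \<tau> \<le> card \<tau>\<^sub>0"
  shows "real n * C_min n p X \<tau>\<^sub>0 \<beta>\<^sub>0 * real (card (\<tau>\<^sub>0 - \<tau>))
           \<le> norm2_sq n (\<lambda>i. lin X \<tau>\<^sub>0 \<beta>\<^sub>0 i - lin X \<tau> \<beta> i)"
proof -
  let ?F = "\<lambda>\<tau> \<beta>. norm2_sq n (\<lambda>i. lin X \<tau>\<^sub>0 \<beta>\<^sub>0 i - lin X \<tau> \<beta> i) / (real n * real (max (card (\<tau>\<^sub>0 - \<tau>)) 1))"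
  let ?A = "{\<tau>. \<tau> \<subseteq> {1..p} \<and> \<tau> \<noteq> \<tau>\<^sub>0 \<and> card \<tau> \<le> card \<tau>\<^sub>0}"
  have "finite ?A" by (rule finite_subset[of _ "Pow {1..p}"]) auto
  then have "C_min n p X \<tau>\<^sub>0 \<beta>\<^sub>0 \<le> (INF \<beta>. ?F \<tau> \<beta>)"
    unfolding C_min_def using \<tau> by (intro Min_le) auto
  also have "\<dots> \<le> ?F \<tau> \<beta>"
    by (intro cINF_lower bdd_belowI[of _ 0]) (auto simp: norm2_sq_def)
  finally have C: "C_min n p X \<tau>\<^sub>0 \<beta>\<^sub>0 \<le> ?F \<tau> \<beta>" .
  have "finite \<tau>\<^sub>0" "finite \<tau>" using \<tau>\<^sub>0 \<tau>(1) finite_subset by blast+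
  have "\<not> \<tau>\<^sub>0 \<subseteq> \<tau>"
    using \<tau>(2,3) card_seteq[OF \<open>finite \<tau>\<close>, of \<tau>\<^sub>0] by auto
  then have "0 < card (\<tau>\<^sub>0 - \<tau>)" using \<open>finite \<tau>\<^sub>0\<close> by (simp add: card_gt_0_iff)
  then have "max (card (\<tau>\<^sub>0 - \<tau>)) 1 = card (\<tau>\<^sub>0 - \<tau>)" by simp
  then show ?thesis using C n \<open>0 < card (\<tau>\<^sub>0 - \<tau>)\<close> by (simp add: field_simps)
qed

text \<open>
  The vector with index \<open>card \<tau>\<close> of \<open>aug_basis n X \<tau> \<mu>\<close> is the normalised residual of \<open>\<mu>\<close> on \<open>X\<^sub>\<tau>\<close>.
\<close>

lemma norm_ge_of_angle:
  assumes fin: "finite \<tau>"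
    and angle: "(ip n (aug_basis n X \<tau> \<mu> (card \<tau>)) u)\<^sup>2 \<le> 7/10 * sqd n (card \<tau>) (model_basis n X \<tau>) u"
    and D: "\<And>\<beta>. D \<le> norm2_sq n (\<lambda>i. \<mu> i - lin X \<tau> \<beta> i)"
  shows "3/10 * D \<le> norm2_sq n (\<lambda>i. \<mu> i - lin X \<tau> \<beta> i - \<sigma> * u i)"
proof -
  let ?k = "card \<tau>" and ?h = "model_basis n X \<tau>"
  note h = subon_model_basis[OF fin, of n X]
  define v w where "v = res n ?k ?h \<mu>" and "w = res n ?k ?h u"
  define g where "g = ip n (aug_basis n X \<tau> \<mu> ?k) u"
  define s where "s = sqrt (sqd n ?k ?h \<mu>)"
  have vv: "ip n v v = s\<^sup>2" using sqd_nonneg[OF h] by (simp add: v_def s_def ip_res_res[OF h])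
  have ww: "ip n w w = sqd n ?k ?h u" by (simp add: w_def ip_res_res[OF h])
  \<comment> \<open>The hypothesis on \<open>D\<close> is applied to the coefficients of the
    projection of \<mu>, whose residual has squared norm \<open>s\<^sup>2\<close>.\<close>
  have "D \<le> s\<^sup>2"
  proof -
    have "\<forall>l\<in>{..<?k}. \<exists>\<beta>. ?h l = lin X \<tau> \<beta>"
      using model_basis_mem[OF fin, of _ n X] by simp
    from bchoice[OF this] obtain \<beta> where "\<forall>l\<in>{..<?k}. ?h l = lin X \<tau> (\<beta> l)" by (elim exE)
    then have \<beta>: "\<And>l. l < ?k \<Longrightarrow> ?h l = lin X \<tau> (\<beta> l)" by simp
    have "proj n ?k ?h \<mu> i = lin X \<tau> (\<lambda>j. \<Sum>l<?k. ip n (?h l) \<mu> * \<beta> l j) i" for i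
    proof -
      have "proj n ?k ?h \<mu> i = (\<Sum>l<?k. ip n (?h l) \<mu> * lin X \<tau> (\<beta> l) i)"
        unfolding proj_def by (intro sum.cong refl) (simp only: \<beta> lessThan_iff)
      then show ?thesis by (simp only: lin_comb_sum)
    qed
    then have "v = (\<lambda>i. \<mu> i - lin X \<tau> (\<lambda>j. \<Sum>l<?k. ip n (?h l) \<mu> * \<beta> l j) i)"
      by (simp add: v_def res_def[abs_def])
    then have "D \<le> norm2_sq n v" using D by simp
    then show ?thesis by (simp add: norm2_sq_ip vv)
  qed
  have "ip n v w = ip n v u"
    using ip_proj_res[OF h, of u \<mu>] unfolding w_def v_def
    by (subst res_def[abs_def]) (simp add: ip_diff_right ip_commute[of n "res n ?k ?h \<mu>"])
  also have "\<dots> = s * g"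
  proof (cases "s = 0")
    case True
    then show ?thesis using ip_self_zero_left[of n v u] vv by simp
  next
    case False
    then show ?thesis
      by (simp add: g_def aug_basis_def gs_step_new ip_divide_left s_def[symmetric] v_def[symmetric])
  qed
  finally have vw: "ip n v w = s * g" .
  have "spans n ?k ?h (\<lambda>i. - 1 * lin X \<tau> \<beta> i + 0 * 0)"
    by (intro spans_comb spans_lin spans_model_basis spans_zero fin)
  then have "spans n ?k ?h (\<lambda>i. - lin X \<tau> \<beta> i)" by simp
  from spans_norm_ge[OF h this, of 1 "\<lambda>i. \<mu> i - \<sigma> * u i"]
  have "sqd n ?k ?h (\<lambda>i. \<mu> i - \<sigma> * u i) \<le> norm2_sq n (\<lambda>i. \<mu> i - lin X \<tau> \<beta> i - \<sigma> * u i)"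
    by (simp add: algebra_simps)
  moreover have "res n ?k ?h (\<lambda>i. \<mu> i - \<sigma> * u i) = (\<lambda>i. v i - \<sigma> * w i)"
    by (simp add: v_def w_def res_def[abs_def] proj_def ip_simps sum_distrib_left sum_subtractf
        algebra_simps)
  then have "sqd n ?k ?h (\<lambda>i. \<mu> i - \<sigma> * u i) = ip n (\<lambda>i. v i - \<sigma> * w i) (\<lambda>i. v i - \<sigma> * w i)"
    by (simp only: ip_res_res[OF h, symmetric])
  then have "sqd n ?k ?h (\<lambda>i. \<mu> i - \<sigma> * u i) = s\<^sup>2 - 2 * \<sigma> * s * g + \<sigma>\<^sup>2 * ip n w w"
    using vw by (simp add: ip_simps vv ip_commute[of n w v] power2_eq_square algebra_simps)
  \<comment> \<open>Once \<open>ip n w w\<close> is replaced by its lower bound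
    \<open>10/7 * g\<^sup>2\<close>, the right side is \<open>3/10 * s\<^sup>2\<close> plus the
    square \<open>7/10 * (s - 10/7 * \<sigma> * g)\<^sup>2\<close>.\<close>
  moreover have "3/10 * s\<^sup>2 \<le> s\<^sup>2 - 2 * \<sigma> * s * g + \<sigma>\<^sup>2 * ip n w w"
  proof -
    have "\<sigma>\<^sup>2 * (10/7 * g\<^sup>2) \<le> \<sigma>\<^sup>2 * ip n w w"
      using angle unfolding ww g_def by (intro mult_left_mono) auto
    moreover have "0 \<le> 7/10 * (s - 10/7 * \<sigma> * g)\<^sup>2" by simp
    ultimately show ?thesis by (simp add: power2_eq_square algebra_simps)
  qed
  ultimately show ?thesis using \<open>D \<le> s\<^sup>2\<close> by linarith
qed

section \<open>Tail bounds\<close>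

text \<open>Markov's inequality for \<open>exp \<phi>\<close>. A non-measurable \<open>A\<close> has
  \<open>measure\<close> 0 by convention, so the bound covers arbitrary sets.\<close>

lemma chernoff:
  assumes "(\<integral>\<^sup>+x. ennreal (exp (\<phi> x)) \<partial>M) \<le> ennreal B" "0 \<le> B"
    and "\<And>x. x \<in> A \<Longrightarrow> 0 \<le> \<phi> x"
  shows "measure M A \<le> B"
proof (cases "A \<in> sets M")
  case True
  have "emeasure M A = (\<integral>\<^sup>+x. indicator A x \<partial>M)" using True by simp
  also have "\<dots> \<le> (\<integral>\<^sup>+x. ennreal (exp (\<phi> x)) \<partial>M)"
    using assms(3) by (intro nn_integral_mono) (auto simp: indicator_def)
  finally have "emeasure M A \<le> ennreal B" using assms(1) by (rule order_trans)
  then show ?thesis using assms(2) by (simp add: measure_def enn2real_leI)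
next
  case False
  then show ?thesis using assms(2) by (simp add: measure_notin_sets)
qed

text \<open>Chernoff parameter \<open>x\<close>: the exponent
  \<open>- x * ip n w U - x\<^sup>2\<close> has exponential moment
  \<open>exp (x\<^sup>2 / 2 - x\<^sup>2)\<close>.\<close>

lemma normal_tail:
  assumes "ip n w w = 1" "0 \<le> x"
  shows "measure (std_normal_vec n) {U \<in> space (std_normal_vec n). ip n w U \<le> - x} \<le> exp (- x\<^sup>2 / 2)"
proof (rule chernoff)
  let ?w = "\<lambda>i. (- x) * w i"
  have w: "ip n ?w U = - x * ip n w U" for U by (rule ip_scale_left)
  have "(\<integral>\<^sup>+U. ennreal (exp (- x * ip n w U - x\<^sup>2)) \<partial>std_normal_vec n)
      = (\<integral>\<^sup>+U. ennreal (exp (- x\<^sup>2)) * ennreal (exp (- 0 * ip n U U + ip n ?w U)) \<partial>std_normal_vec n)"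
    unfolding w by (intro nn_integral_cong) (simp add: ennreal_mult[symmetric] mult_exp_exp)
  also have "\<dots> = ennreal (exp (- x\<^sup>2)) * (\<integral>\<^sup>+U. ennreal (exp (- 0 * ip n U U + ip n ?w U)) \<partial>std_normal_vec n)"
    by (rule nn_integral_cmult)
      (use measurable_std_normal_vec_component in \<open>measurable\<close>)
  also have "\<dots> = ennreal (exp (- x\<^sup>2)) * ennreal (exp (x\<^sup>2 / 2))"
    by (subst nn_integral_std_normal_vec_exp_quad)
      (simp_all only: ip_scale_left ip_scale_right assms(1), simp_all add: power2_eq_square)
  also have "\<dots> = ennreal (exp (- x\<^sup>2 / 2))"
    by (simp add: ennreal_mult[symmetric] mult_exp_exp)
  finally show "(\<integral>\<^sup>+U. ennreal (exp (- x * ip n w U - x\<^sup>2)) \<partial>std_normal_vec n) \<le> ennreal (exp (- x\<^sup>2 / 2))"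
    by simp
next
  fix U assume "U \<in> {U \<in> space (std_normal_vec n). ip n w U \<le> - x}"
  then have "x * ip n w U \<le> x * (- x)" using assms(2) by (intro mult_left_mono) auto
  then show "0 \<le> - x * ip n w U - x\<^sup>2" by (simp add: power2_eq_square)
qed simp

text \<open>Chernoff parameter \<open>1/3\<close>: each of the last \<open>j\<close> vectors
  contributes a factor of at most \<open>1 / sqrt (1 - 2/3) = sqrt 3\<close>, and the first
  \<open>r\<close> vectors get weight 0.\<close>

lemma chi_square_tail:
  assumes f: "subon n (r + j) f"
  shows "measure (std_normal_vec n)
           {U \<in> space (std_normal_vec n). x \<le> (\<Sum>l\<in>{r..<r + j}. (ip n (f l) U)\<^sup>2)}
         \<le> sqrt 3 ^ j * exp (- x / 3)"
proof (rule chernoff)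
  define b :: "nat \<Rightarrow> real" where "b l = (if l < r then 0 else 1/3)" for l
  have split: "{..<r + j} = {..<r} \<union> {r..<r + j}" by auto
  have b_sum: "(\<Sum>l<r + j. b l * (ip n (f l) U)\<^sup>2) = (\<Sum>l\<in>{r..<r + j}. (ip n (f l) U)\<^sup>2) / 3" for U
    unfolding split by (subst sum.union_disjoint) (auto simp: b_def sum_divide_distrib intro!: sum.cong)
  have b_prod: "(\<Prod>l<r + j. 1 / sqrt (1 - 2 * b l / (1 + 2 * 0))) = sqrt 3 ^ j"
  proof -
    have "(\<Prod>l\<in>{..<r}. 1 / sqrt (1 - 2 * b l / (1 + 2 * 0))) = 1" by (simp add: b_def)
    moreover have "(\<Prod>l\<in>{r..<r + j}. 1 / sqrt (1 - 2 * b l / (1 + 2 * 0))) = (\<Prod>l\<in>{r..<r + j}. sqrt 3)"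
      by (intro prod.cong) (auto simp: b_def real_sqrt_divide)
    ultimately show ?thesis unfolding split by (subst prod.union_disjoint) auto
  qed
  have "(\<integral>\<^sup>+U. ennreal (exp ((\<Sum>l\<in>{r..<r + j}. (ip n (f l) U)\<^sup>2) / 3 - x / 3)) \<partial>std_normal_vec n)
      = (\<integral>\<^sup>+U. ennreal (exp (- x / 3))
             * ennreal (exp (- 0 * ip n U U + (\<Sum>l<r + j. b l * (ip n (f l) U)\<^sup>2))) \<partial>std_normal_vec n)"
    unfolding b_sum by (intro nn_integral_cong) (simp add: ennreal_mult[symmetric] mult_exp_exp)
  also have "\<dots> = ennreal (exp (- x / 3)) * (\<integral>\<^sup>+U.
       ennreal (exp (- 0 * ip n U U + (\<Sum>l<r + j. b l * (ip n (f l) U)\<^sup>2))) \<partial>std_normal_vec n)"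
    by (rule nn_integral_cmult) (use measurable_std_normal_vec_component in \<open>measurable\<close>)
  also have "\<dots> \<le> ennreal (exp (- x / 3)) * ennreal (sqrt 3 ^ j / sqrt (1 + 2 * 0) ^ n)"
    using nn_integral_std_normal_vec_exp_forms[OF f, of 0 b] unfolding b_prod
    by (intro mult_left_mono) (auto simp: b_def)
  also have "\<dots> = ennreal (sqrt 3 ^ j * exp (- x / 3))"
    by (simp add: ennreal_mult[symmetric] mult.commute)
  finally show "(\<integral>\<^sup>+U. ennreal (exp ((\<Sum>l\<in>{r..<r + j}. (ip n (f l) U)\<^sup>2) / 3 - x / 3)) \<partial>std_normal_vec n)
     \<le> ennreal (sqrt 3 ^ j * exp (- x / 3))" .
qed auto

text \<open>For an orthonormal family, each direction orthogonal to it has weight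
  \<open>- 7/8\<close> in the exponent and contributes \<open>1 / sqrt (11/4)\<close>, while
  \<open>f r\<close> has weight \<open>5/4 - 7/8\<close> and contributes 2. As \<open>11/4\<close>
  exceeds \<open>exp 1\<close>, the rate \<open>(n - r) / 2\<close> follows later.\<close>

lemma angle_tail:
  assumes f: "subon n (Suc r) f"
  shows "measure (std_normal_vec n)
           {u \<in> space (std_normal_vec n). 7/10 * sqd n r f u \<le> (ip n (f r) u)\<^sup>2}
         \<le> sqrt 11 * sqrt (11/4) ^ r / sqrt (11/4) ^ n"
proof (rule chernoff)
  \<comment> \<open>Chernoff parameter \<open>5/4\<close>: the weight of \<open>- |u|\<^sup>2\<close> in \<open>sqd\<close> becomes \<open>5/4 * 7/10 = 7/8\<close>.\<close>
  define b :: "nat \<Rightarrow> real" where "b l = (if l < r then 7/8 else 5/4)" for l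
  have b_prod: "(\<Prod>l<Suc r. 1 / sqrt (1 - 2 * b l / (1 + 2 * (7/8)))) = sqrt (11/4) ^ r * sqrt 11"
    by (simp add: b_def real_sqrt_divide power_divide)
  have "(\<integral>\<^sup>+u. ennreal (exp (5/4 * ((ip n (f r) u)\<^sup>2 - 7/10 * sqd n r f u))) \<partial>std_normal_vec n)
     = (\<integral>\<^sup>+u. ennreal (exp (- (7/8) * ip n u u + (\<Sum>l<Suc r. b l * (ip n (f l) u)\<^sup>2))) \<partial>std_normal_vec n)"
    by (intro nn_integral_cong) (simp add: b_def sqd_def sum_distrib_left algebra_simps)
  also have "\<dots> \<le> ennreal ((sqrt (11/4) ^ r * sqrt 11) / sqrt (1 + 2 * (7/8)) ^ n)"
    using nn_integral_std_normal_vec_exp_forms[OF f, of "7/8" b] unfolding b_prod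
    by (auto simp: b_def)
  finally show "(\<integral>\<^sup>+u. ennreal (exp (5/4 * ((ip n (f r) u)\<^sup>2 - 7/10 * sqd n r f u))) \<partial>std_normal_vec n)
     \<le> ennreal (sqrt 11 * sqrt (11/4) ^ r / sqrt (11/4) ^ n)"
    by (simp add: mult.commute)
qed auto

section \<open>Failure probability for a fixed repro noise\<close>

lemma sum_Pow_power:
  fixes x :: "'a :: comm_semiring_1"
  assumes "finite S"
  shows "(\<Sum>A\<in>Pow S. x ^ card A) = (1 + x) ^ card S"
  using prod_add[OF assms, of "\<lambda>_. x" "\<lambda>_. 1"] by (simp add: add.commute)

lemma sum_Pow_power_nonempty:
  fixes x :: "'a :: comm_ring_1"
  assumes "finite S"
  shows "(\<Sum>A\<in>Pow S - {{}}. x ^ card A) = (1 + x) ^ card S - 1"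
  using sum_Pow_power[OF assms, of x] assms by (simp add: sum.remove[of "Pow S" "{}"] eq_diff_eq add.commute)

text \<open>The deterministic assumptions for one fixed \<open>n\<close>, with the range of
  \<open>lam / n\<close> multiplied by \<open>n\<close> to clear denominators.\<close>

locale repro_setup =
  fixes n p :: nat and X :: "nat \<Rightarrow> nat \<Rightarrow> real" and \<tau>\<^sub>0 :: "nat set" and \<beta>\<^sub>0 :: "nat \<Rightarrow> real"
    and \<sigma>\<^sub>0 lam t :: real
  assumes n: "0 < n" and \<tau>\<^sub>0: "\<tau>\<^sub>0 \<subseteq> {1..p}" "\<tau>\<^sub>0 \<noteq> {}" and \<sigma>\<^sub>0: "0 < \<sigma>\<^sub>0" and lam: "0 < lam"
    and lam_ge: "6 * \<sigma>\<^sub>0\<^sup>2 * (real (card \<tau>\<^sub>0) + 1) * ln (real p / 2) + real n * t \<le> lam"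
    and lam_le: "lam \<le> 0.05 * (real n * C_min n p X \<tau>\<^sub>0 \<beta>\<^sub>0)"
    and t: "0 < t"
begin

abbreviation "\<mu> \<equiv> lin X \<tau>\<^sub>0 \<beta>\<^sub>0"
abbreviation "m \<equiv> card \<tau>\<^sub>0"
abbreviation "D \<equiv> real n * C_min n p X \<tau>\<^sub>0 \<beta>\<^sub>0"
abbreviation "N \<equiv> std_normal_vec n"

definition good :: "(nat \<Rightarrow> real) \<Rightarrow> bool" where
  "good u \<longleftrightarrow> (\<forall>\<tau> \<beta> \<sigma>. \<tau> \<subseteq> {1..p} \<longrightarrow> \<tau> \<noteq> \<tau>\<^sub>0 \<longrightarrow> card \<tau> \<le> m \<longrightarrow>
     3/10 * (D * real (card (\<tau>\<^sub>0 - \<tau>))) \<le> norm2_sq n (\<lambda>i. \<mu> i - lin X \<tau> \<beta> i - \<sigma> * u i))"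

text \<open>The inequality is weak, so a tie counts as failure; this covers every tie-breaking
  rule.\<close>

definition fail :: "(nat \<Rightarrow> real) \<Rightarrow> (nat \<Rightarrow> real) \<Rightarrow> nat set \<Rightarrow> bool" where
  "fail u U \<tau> \<longleftrightarrow> criterion n X lam (response X \<tau>\<^sub>0 \<beta>\<^sub>0 \<sigma>\<^sub>0 U) u \<tau>
                \<le> criterion n X lam (response X \<tau>\<^sub>0 \<beta>\<^sub>0 \<sigma>\<^sub>0 U) u \<tau>\<^sub>0"

lemma D_pos: "0 < D"
  using lam lam_le by simp

lemma finite_model: "\<tau> \<subseteq> {1..p} \<Longrightarrow> finite \<tau>"
  using finite_subset by blast

lemma finite_\<tau>\<^sub>0: "finite \<tau>\<^sub>0"
  using \<tau>\<^sub>0(1) by (rule finite_model)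

lemma m_pos: "0 < m"
  using \<tau>\<^sub>0(2) finite_\<tau>\<^sub>0 by (simp add: card_gt_0_iff)

lemma m_le: "m \<le> p"
  using card_mono[OF _ \<tau>\<^sub>0(1)] by simp

text \<open>Both sides count \<open>\<tau> \<union> \<tau>\<^sub>0\<close>.\<close>

lemma card_model: "finite \<tau> \<Longrightarrow> card \<tau> + card (\<tau>\<^sub>0 - \<tau>) = m + card (\<tau> - \<tau>\<^sub>0)"
  using card_Diff_subset_Int[of \<tau>\<^sub>0 \<tau>] card_Diff_subset_Int[of \<tau> \<tau>\<^sub>0] finite_\<tau>\<^sub>0
    card_mono[of \<tau> "\<tau> \<inter> \<tau>\<^sub>0"] card_mono[of \<tau>\<^sub>0 "\<tau> \<inter> \<tau>\<^sub>0"]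
  by (simp add: Int_commute)

lemma card_missing_pos: "finite \<tau> \<Longrightarrow> \<tau> \<noteq> \<tau>\<^sub>0 \<Longrightarrow> card \<tau> \<le> m \<Longrightarrow> 0 < card (\<tau>\<^sub>0 - \<tau>)"
  using card_seteq[of \<tau> \<tau>\<^sub>0] finite_\<tau>\<^sub>0 by (auto simp: card_gt_0_iff)

section \<open>Failure in terms of Gaussian statistics\<close>

lemma ext_basis_exists:
  assumes "finite J"
  shows "\<exists>g. subon n (Suc m + card J) g \<and> (\<forall>l<Suc m. g l = aug_basis n X \<tau>\<^sub>0 u l) \<and>
           (\<forall>j\<in>\<tau>\<^sub>0 \<union> J. spans n (Suc m + card J) g (\<lambda>i. X i j)) \<and> spans n (Suc m + card J) g u"
proof -
  have "\<exists>g. subon n (Suc m + card J) g \<and> (\<forall>l<Suc m. g l = aug_basis n X \<tau>\<^sub>0 u l) \<and>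
           (\<forall>l<Suc m + card J. g l \<in> UNIV) \<and>
           (\<forall>x. spans n (Suc m) (aug_basis n X \<tau>\<^sub>0 u) x \<longrightarrow> spans n (Suc m + card J) g x) \<and>
           (\<forall>j\<in>J. spans n (Suc m + card J) g (\<lambda>i. X i j))"
    by (rule gs_extend) (rule assms subon_aug_basis[OF finite_\<tau>\<^sub>0] UNIV_I)+
  then show ?thesis
    using spans_aug_basis[OF finite_\<tau>\<^sub>0, of _ n X u] spans_aug_basis_noise[OF finite_\<tau>\<^sub>0, of n X u] by blast
qed

text \<open>The index is \<open>J\<close>, later \<open>\<tau> - \<tau>\<^sub>0\<close>, rather than
  \<tau> itself: models with the same extra columns share one basis, which permits a union bound
  over \<open>J\<close> alone.\<close>

definition ext_basis :: "(nat \<Rightarrow> real) \<Rightarrow> nat set \<Rightarrow> nat \<Rightarrow> nat \<Rightarrow> real" where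
  "ext_basis u J = (SOME g. subon n (Suc m + card J) g \<and> (\<forall>l<Suc m. g l = aug_basis n X \<tau>\<^sub>0 u l) \<and>
           (\<forall>j\<in>\<tau>\<^sub>0 \<union> J. spans n (Suc m + card J) g (\<lambda>i. X i j)) \<and> spans n (Suc m + card J) g u)"

lemma ext_basis:
  assumes "finite J"
  shows subon_ext_basis: "subon n (Suc m + card J) (ext_basis u J)"
    and ext_basis_old: "l < Suc m \<Longrightarrow> ext_basis u J l = aug_basis n X \<tau>\<^sub>0 u l"
    and spans_ext_basis: "j \<in> \<tau>\<^sub>0 \<union> J \<Longrightarrow> spans n (Suc m + card J) (ext_basis u J) (\<lambda>i. X i j)"
    and spans_ext_basis_noise: "spans n (Suc m + card J) (ext_basis u J) u"
  using someI_ex[OF ext_basis_exists[OF assms, of u], folded ext_basis_def] by blast+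

text \<open>The squared norm of what the columns in \<open>J\<close> explain of \<open>U\<close>
  beyond \<open>\<tau>\<^sub>0\<close> and \<open>u\<close>. For fixed \<open>u\<close> it is a
  chi-square variable with at most \<open>card J\<close> degrees of freedom.\<close>

definition chi :: "(nat \<Rightarrow> real) \<Rightarrow> nat set \<Rightarrow> (nat \<Rightarrow> real) \<Rightarrow> real" where
  "chi u J U = (\<Sum>l\<in>{Suc m..<Suc m + card J}. (ip n (ext_basis u J l) U)\<^sup>2)"

lemma measurable_chi [measurable]: "chi u J \<in> borel_measurable N"
  unfolding chi_def using measurable_std_normal_vec_component by measurable

lemma measurable_ip_const [measurable]: "(\<lambda>U. ip n w U) \<in> borel_measurable N"
  using measurable_std_normal_vec_component by measurable

lemma measurable_response: "i \<in> {1..n} \<Longrightarrow> (\<lambda>U. response X \<tau>\<^sub>0 \<beta>\<^sub>0 \<sigma>\<^sub>0 U i) \<in> borel_measurable N"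
  unfolding response_def
  by (intro borel_measurable_add borel_measurable_times borel_measurable_const
      measurable_std_normal_vec_component)

lemma sets_fail:
  assumes "finite \<tau>"
  shows "{U \<in> space N. fail u U \<tau>} \<in> sets N"
proof -
  have crit [measurable]:
    "(\<lambda>U. criterion n X lam (response X \<tau>\<^sub>0 \<beta>\<^sub>0 \<sigma>\<^sub>0 U) u \<tau>) \<in> borel_measurable N"
    if "finite \<tau>" for \<tau>
    using that
    by (rule measurable_criterion) (assumption | erule measurable_response | rule borel_measurable_const)+
  show ?thesis
    unfolding fail_def using crit[OF assms] crit[OF finite_\<tau>\<^sub>0] by measurable
qed

text \<open>The mean lies in the span of the columns of \<open>\<tau>\<^sub>0\<close>, so only
  \<open>\<sigma>\<^sub>0 * U\<close> leaves a residual. It is split into the part outside the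
  extended span, which a competing model cannot remove either, and \<open>chi\<close>.\<close>

lemma criterion_true:
  assumes "finite J"
  shows "criterion n X lam (response X \<tau>\<^sub>0 \<beta>\<^sub>0 \<sigma>\<^sub>0 U) u \<tau>\<^sub>0
    = \<sigma>\<^sub>0\<^sup>2 * sqd n (Suc m + card J) (ext_basis u J) U + \<sigma>\<^sub>0\<^sup>2 * chi u J U + lam * real m"
proof -
  let ?f = "aug_basis n X \<tau>\<^sub>0 u" and ?g = "ext_basis u J"
  have split: "{..<Suc m + card J} = {..<Suc m} \<union> {Suc m..<Suc m + card J}" by auto
  have resp: "response X \<tau>\<^sub>0 \<beta>\<^sub>0 \<sigma>\<^sub>0 U = (\<lambda>i. \<sigma>\<^sub>0 * U i + \<mu> i)" by (auto simp: response_def)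
  have "spans n (Suc m) ?f \<mu>" by (intro spans_lin spans_aug_basis finite_\<tau>\<^sub>0)
  then have "sqd n (Suc m) ?f (response X \<tau>\<^sub>0 \<beta>\<^sub>0 \<sigma>\<^sub>0 U) = \<sigma>\<^sub>0\<^sup>2 * sqd n (Suc m) ?f U"
    unfolding resp by (rule spans_sqd_add[OF subon_aug_basis[OF finite_\<tau>\<^sub>0]])
  moreover have "sqd n (Suc m) ?f U = sqd n (Suc m + card J) ?g U + chi u J U"
  proof -
    have "(\<Sum>l\<in>{..<Suc m}. (ip n (?f l) U)\<^sup>2) = (\<Sum>l\<in>{..<Suc m}. (ip n (?g l) U)\<^sup>2)"
      by (intro sum.cong) (auto simp: ext_basis_old[OF assms] simp del: lessThan_Suc)
    moreover have "(\<Sum>l\<in>{..<Suc m + card J}. (ip n (?g l) U)\<^sup>2)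
        = (\<Sum>l\<in>{..<Suc m}. (ip n (?g l) U)\<^sup>2) + chi u J U"
      unfolding split chi_def by (rule sum.union_disjoint) auto
    ultimately show ?thesis by (simp add: sqd_def del: lessThan_Suc sum.lessThan_Suc)
  qed
  ultimately show ?thesis by (simp add: criterion_eq[OF finite_\<tau>\<^sub>0] algebra_simps)
qed

lemma spans_difference:
  assumes "finite \<tau>"
  shows "spans n (Suc m + card (\<tau> - \<tau>\<^sub>0)) (ext_basis u (\<tau> - \<tau>\<^sub>0)) (\<lambda>i. \<mu> i - lin X \<tau> \<beta> i - \<sigma> * u i)"
proof -
  have J: "finite (\<tau> - \<tau>\<^sub>0)" using assms by simp
  let ?sp = "spans n (Suc m + card (\<tau> - \<tau>\<^sub>0)) (ext_basis u (\<tau> - \<tau>\<^sub>0))"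
  have "?sp \<mu>" "?sp (lin X \<tau> \<beta>)"
    by (intro spans_lin spans_ext_basis finite_\<tau>\<^sub>0 assms J; blast)+
  from spans_comb[OF spans_comb[OF this, of 1 "-1"] spans_ext_basis_noise[OF J], of 1 "- \<sigma>"]
  show ?thesis by simp
qed

lemma response_residual:
  "(\<lambda>i. response X \<tau>\<^sub>0 \<beta>\<^sub>0 \<sigma>\<^sub>0 U i - lin X \<tau> \<beta> i - \<sigma> * u i)
    = (\<lambda>i. \<sigma>\<^sub>0 * U i + (\<mu> i - lin X \<tau> \<beta> i - \<sigma> * u i))"
  by (auto simp: response_def)

text \<open>Under \<tau> the residual differs from \<open>\<sigma>\<^sub>0 * U\<close> by a vector
  of the extended span. Its squared norm is thus at least the first term of
  \<open>criterion_true\<close>, which cancels. This is informative when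
  \<open>card \<tau> > m\<close>.\<close>

lemma fail_imp_chi:
  assumes fin: "finite \<tau>" and "fail u U \<tau>"
  shows "lam * (real (card \<tau>) - real m) \<le> \<sigma>\<^sub>0\<^sup>2 * chi u (\<tau> - \<tau>\<^sub>0) U"
proof -
  have J: "finite (\<tau> - \<tau>\<^sub>0)" using fin by simp
  let ?g = "ext_basis u (\<tau> - \<tau>\<^sub>0)" and ?R = "Suc m + card (\<tau> - \<tau>\<^sub>0)"
  have "\<sigma>\<^sub>0\<^sup>2 * sqd n ?R ?g U + lam * real (card \<tau>)
      \<le> criterion n X lam (response X \<tau>\<^sub>0 \<beta>\<^sub>0 \<sigma>\<^sub>0 U) u \<tau>"
    by (rule criterion_ge, unfold response_residual,
        rule spans_norm_ge[OF subon_ext_basis[OF J] spans_difference[OF fin]])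
  also have "\<dots> \<le> \<sigma>\<^sub>0\<^sup>2 * sqd n ?R ?g U + \<sigma>\<^sub>0\<^sup>2 * chi u (\<tau> - \<tau>\<^sub>0) U + lam * real m"
    using assms(2) unfolding fail_def criterion_true[OF J] .
  finally show ?thesis by (simp add: algebra_simps)
qed

text \<open>\<open>a\<close> is the distance of the mean to the span of the columns of \<tau> and
  \<open>u\<close>, and \<open>w\<close> the unit vector along the residual. As \<open>w\<close> is
  orthogonal to that span, every residual of the response has component
  \<open>a + \<sigma>\<^sub>0 * ip n w U\<close> along \<open>w\<close>, whose square is gained on
  top of the cancelling part.\<close>

lemma fail_imp_shifted_chi:
  assumes \<tau>: "\<tau> \<subseteq> {1..p}" "\<tau> \<noteq> \<tau>\<^sub>0" "card \<tau> \<le> m" and good: "good u"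
  shows "\<exists>a w. 0 < a \<and> 3/10 * (D * real (card (\<tau>\<^sub>0 - \<tau>))) \<le> a\<^sup>2 \<and> ip n w w = 1 \<and>
           (\<forall>U. fail u U \<tau> \<longrightarrow>
              (a + \<sigma>\<^sub>0 * ip n w U)\<^sup>2 \<le> \<sigma>\<^sub>0\<^sup>2 * chi u (\<tau> - \<tau>\<^sub>0) U + lam * (real m - real (card \<tau>)))"
proof -
  have fin: "finite \<tau>" using \<tau>(1) by (rule finite_model)
  then have J: "finite (\<tau> - \<tau>\<^sub>0)" by simp
  let ?g = "ext_basis u (\<tau> - \<tau>\<^sub>0)" and ?R = "Suc m + card (\<tau> - \<tau>\<^sub>0)"
  let ?f = "aug_basis n X \<tau> u" and ?r = "Suc (card \<tau>)"
  note f = subon_aug_basis[OF fin, of n X u]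
  define a where "a = sqrt (sqd n ?r ?f \<mu>)"
  define w where "w = (\<lambda>i. (1 / a) * res n ?r ?f \<mu> i)"
  obtain \<beta> \<sigma> where \<beta>\<sigma>: "proj n ?r ?f \<mu> = (\<lambda>i. lin X \<tau> \<beta> i + \<sigma> * u i)"
    using aug_basis_proj[OF fin] by blast
  have res: "res n ?r ?f \<mu> = (\<lambda>i. \<mu> i - lin X \<tau> \<beta> i - \<sigma> * u i)"
    by (simp add: res_def[abs_def] \<beta>\<sigma> algebra_simps)
  have a2: "a\<^sup>2 = sqd n ?r ?f \<mu>" using sqd_nonneg[OF f] by (simp add: a_def)
  have ge: "3/10 * (D * real (card (\<tau>\<^sub>0 - \<tau>))) \<le> a\<^sup>2"
    using good \<tau> unfolding good_def a2 ip_res_res[OF f, symmetric] res norm2_sq_ip[symmetric] by blast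
  then have "0 < a\<^sup>2" using D_pos card_missing_pos[OF fin \<tau>(2,3)]
    by (intro less_le_trans[OF _ ge]) auto
  then have a: "0 < a" using sqd_nonneg[OF f, of \<mu>] unfolding a_def by auto
  have ww: "ip n w w = 1"
    unfolding w_def ip_scale_left ip_scale_right ip_res_res[OF f] a2[symmetric] using a
    by (simp add: power2_eq_square)
  have wx: "ip n w x = 0" if "spans n ?r ?f x" for x
    unfolding w_def ip_scale_left
    using spans_ip[OF that, of "res n ?r ?f \<mu>"] ip_res[OF f] by (simp add: ip_commute)
  have "ip n (res n ?r ?f \<mu>) \<mu> = a\<^sup>2"
    using ip_proj_res[OF f, of \<mu> \<mu>] ip_res_res[OF f, of \<mu>]
      ip_add_right[of n "res n ?r ?f \<mu>" "res n ?r ?f \<mu>" "proj n ?r ?f \<mu>"]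
    by (simp add: res_def ip_commute a2)
  then have w\<mu>: "ip n w \<mu> = a"
    unfolding w_def ip_scale_left using a by (simp add: power2_eq_square)
  \<comment> \<open>\<open>w\<close> is a multiple of the mean minus its fit, hence in the extended
    span; the zero multiple only matches the form of \<open>spans_comb\<close>.\<close>
  have "spans n ?R ?g (\<lambda>i. (1 / a) * (\<mu> i - lin X \<tau> \<beta> i - \<sigma> * u i) + 0 * (\<mu> i - lin X \<tau> \<beta> i - \<sigma> * u i))"
    by (intro spans_comb spans_difference fin)
  then have w_sp: "spans n ?R ?g w" by (simp add: w_def res)
  have "(a + \<sigma>\<^sub>0 * ip n w U)\<^sup>2 \<le> \<sigma>\<^sub>0\<^sup>2 * chi u (\<tau> - \<tau>\<^sub>0) U + lam * (real m - real (card \<tau>))"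
    if "fail u U \<tau>" for U
  proof -
    have "(a + \<sigma>\<^sub>0 * ip n w U)\<^sup>2 + \<sigma>\<^sub>0\<^sup>2 * sqd n ?R ?g U + lam * real (card \<tau>)
       \<le> criterion n X lam (response X \<tau>\<^sub>0 \<beta>\<^sub>0 \<sigma>\<^sub>0 U) u \<tau>"
    proof (rule criterion_ge, unfold response_residual)
      fix \<beta>' \<sigma>'
      have "spans n ?r ?f (\<lambda>i. 1 * lin X \<tau> \<beta>' i + \<sigma>' * u i)"
        by (intro spans_comb spans_lin spans_aug_basis spans_aug_basis_noise fin)
      from wx[OF this] have "ip n w (lin X \<tau> \<beta>') + \<sigma>' * ip n w u = 0"
        by (simp add: ip_add_right ip_scale_right)
      then have "ip n w (\<lambda>i. \<sigma>\<^sub>0 * U i + (\<mu> i - lin X \<tau> \<beta>' i - \<sigma>' * u i)) = a + \<sigma>\<^sub>0 * ip n w U"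
        unfolding ip_add_right ip_diff_right ip_scale_right w\<mu> by simp
      then show "(a + \<sigma>\<^sub>0 * ip n w U)\<^sup>2 + \<sigma>\<^sub>0\<^sup>2 * sqd n ?R ?g U
          \<le> norm2_sq n (\<lambda>i. \<sigma>\<^sub>0 * U i + (\<mu> i - lin X \<tau> \<beta>' i - \<sigma>' * u i))"
        using spans_norm_ge_direction[OF subon_ext_basis[OF J] spans_difference[OF fin] w_sp ww,
            of \<sigma>\<^sub>0 U \<beta>' \<sigma>'] by simp
    qed
    also have "\<dots> \<le> \<sigma>\<^sub>0\<^sup>2 * sqd n ?R ?g U + \<sigma>\<^sub>0\<^sup>2 * chi u (\<tau> - \<tau>\<^sub>0) U + lam * real m"
      using that unfolding fail_def criterion_true[OF J] .
    finally show ?thesis by (simp add: algebra_simps)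
  qed
  then show ?thesis using a ge ww by blast
qed

section \<open>Models not larger than the true one\<close>

definition q :: real where "q = exp (- D / (60 * \<sigma>\<^sub>0\<^sup>2))"

text \<open>Failure needs a strongly negative linear form, of probability at most
  \<open>q ^ k\<close>, or a large \<open>chi\<close>, of probability at most
  \<open>sqrt 3 ^ j * q ^ (k + j)\<close>. The hypothesis \<open>2 * q \<le> 1\<close> absorbs
  \<open>sqrt 3 ^ j\<close> into \<open>q ^ j\<close>.\<close>

lemma prob_fail_small:
  assumes \<tau>: "\<tau> \<subseteq> {1..p}" "\<tau> \<noteq> \<tau>\<^sub>0" "card \<tau> \<le> m" and good: "good u" and q: "2 * q \<le> 1"
  shows "measure N {U \<in> space N. fail u U \<tau>} \<le> 2 * q ^ card (\<tau>\<^sub>0 - \<tau>)"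
proof -
  interpret N: prob_space N by (rule prob_space_std_normal_vec)
  have fin: "finite \<tau>" using \<tau>(1) by (rule finite_model)
  define j k where "j = card (\<tau> - \<tau>\<^sub>0)" and "k = card (\<tau>\<^sub>0 - \<tau>)"
  have jk: "real m - real (card \<tau>) = real k - real j" "j \<le> k"
    using card_model[OF fin] \<tau>(3) by (auto simp: j_def k_def)
  obtain a w where a: "0 < a" "3/10 * (D * real k) \<le> a\<^sup>2" and w: "ip n w w = 1"
    and fail: "\<And>U. fail u U \<tau> \<Longrightarrow>
       (a + \<sigma>\<^sub>0 * ip n w U)\<^sup>2 \<le> \<sigma>\<^sub>0\<^sup>2 * chi u (\<tau> - \<tau>\<^sub>0) U + lam * (real k - real j)"
    using fail_imp_shifted_chi[OF \<tau> good] unfolding jk(1) k_def[symmetric] by blast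
  \<comment> \<open>Outside \<open>?A\<close> the square is at least \<open>a\<^sup>2 / 3\<close>,
    hence at least \<open>D * k / 10\<close>; taking off the penalty gain of at most
    \<open>D * (k - j) / 20\<close> leaves \<open>D * (k + j) / 20\<close>. The 60 in
    \<open>q\<close> fits both tails: it is 18 divided by \<open>3/10\<close>, and 3 times
    20.\<close>
  define x where "x = D * real (k + j) / (20 * \<sigma>\<^sub>0\<^sup>2)"
  let ?A = "{U \<in> space N. ip n w U \<le> - (a / (3 * \<sigma>\<^sub>0))}"
  let ?B = "{U \<in> space N. x \<le> chi u (\<tau> - \<tau>\<^sub>0) U}"
  have "fail u U \<tau> \<Longrightarrow> ip n w U \<le> - (a / (3 * \<sigma>\<^sub>0)) \<or> x \<le> chi u (\<tau> - \<tau>\<^sub>0) U" for U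
  proof -
    assume "fail u U \<tau>"
    note f = fail[OF this]
    show ?thesis
    proof (cases "ip n w U \<le> - (a / (3 * \<sigma>\<^sub>0))")
      case False
      then have "- (a / 3) \<le> \<sigma>\<^sub>0 * ip n w U" using \<sigma>\<^sub>0 by (simp add: field_simps)
      then have "a * - (a / 3) \<le> a * (\<sigma>\<^sub>0 * ip n w U)" using a(1) by (intro mult_left_mono) auto
      moreover have "(a + \<sigma>\<^sub>0 * ip n w U)\<^sup>2 = a\<^sup>2 + 2 * (a * (\<sigma>\<^sub>0 * ip n w U)) + (\<sigma>\<^sub>0 * ip n w U)\<^sup>2"
        by (simp add: power2_eq_square algebra_simps)
      moreover have "0 \<le> (\<sigma>\<^sub>0 * ip n w U)\<^sup>2" by simp
      moreover have "a * - (a / 3) = - (a\<^sup>2 / 3)" by (simp add: power2_eq_square)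
      ultimately have "a\<^sup>2 / 3 \<le> (a + \<sigma>\<^sub>0 * ip n w U)\<^sup>2" by linarith
      then have "1/10 * (D * real k) \<le> \<sigma>\<^sub>0\<^sup>2 * chi u (\<tau> - \<tau>\<^sub>0) U + lam * (real k - real j)"
        using f a(2) by linarith
      moreover have "lam * (real k - real j) \<le> (0.05 * D) * (real k - real j)"
        using jk(2) lam_le by (intro mult_right_mono) auto
      ultimately have "D * real (k + j) / 20 \<le> \<sigma>\<^sub>0\<^sup>2 * chi u (\<tau> - \<tau>\<^sub>0) U"
        by (simp add: algebra_simps)
      then show ?thesis using \<sigma>\<^sub>0 by (simp add: x_def field_simps)
    qed simp
  qed
  then have "measure N {U \<in> space N. fail u U \<tau>} \<le> measure N (?A \<union> ?B)"
    by (intro N.finite_measure_mono) (auto intro!: sets.Un)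
  also have "\<dots> \<le> measure N ?A + measure N ?B"
    by (intro measure_Un_le) auto
  also have "measure N ?A \<le> exp (- (a / (3 * \<sigma>\<^sub>0))\<^sup>2 / 2)"
    using a(1) \<sigma>\<^sub>0 by (intro normal_tail[OF w]) simp
  also have "\<dots> \<le> q ^ k"
  proof -
    have "real k * (D / (60 * \<sigma>\<^sub>0\<^sup>2)) = 3/10 * (D * real k) / (18 * \<sigma>\<^sub>0\<^sup>2)" by simp
    also have "\<dots> \<le> a\<^sup>2 / (18 * \<sigma>\<^sub>0\<^sup>2)" by (intro divide_right_mono a(2)) simp
    also have "\<dots> = (a / (3 * \<sigma>\<^sub>0))\<^sup>2 / 2" by (simp add: power_divide power_mult_distrib)
    finally show ?thesis unfolding q_def exp_of_nat_mult[symmetric] by simp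
  qed
  also have "measure N ?B \<le> sqrt 3 ^ j * exp (- x / 3)"
    unfolding chi_def j_def using fin by (intro chi_square_tail subon_ext_basis) auto
  also have "exp (- x / 3) = q ^ (k + j)"
    unfolding q_def exp_of_nat_mult[symmetric] x_def by (simp add: field_simps)
  also have "sqrt 3 ^ j * q ^ (k + j) = (sqrt 3 * q) ^ j * q ^ k"
    by (simp add: power_add power_mult_distrib)
  also have "\<dots> \<le> 1 * q ^ k"
  proof (intro mult_right_mono power_le_one)
    have "sqrt 3 \<le> 2" by (rule real_le_lsqrt) auto
    then have "sqrt 3 * q \<le> 2 * q" by (intro mult_right_mono) (auto simp: q_def)
    then show "sqrt 3 * q \<le> 1" using q by simp
  qed (auto simp: q_def)
  finally show ?thesis by (simp add: k_def)
qed

text \<open>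
  A model is determined by the pair \<open>(\<tau>\<^sub>0 - \<tau>, \<tau> - \<tau>\<^sub>0)\<close>. The factor \<open>p ^ (|\<tau>\<^sub>0 - \<tau>| - |\<tau> - \<tau>\<^sub>0|) \<ge> 1\<close>
  turns the sum into a product of two binomial sums.
\<close>

lemma sum_small_models:
  assumes q: "6 * (real p + 1)\<^sup>2 * q \<le> 1"
  shows "(\<Sum>\<tau> | \<tau> \<subseteq> {1..p} \<and> \<tau> \<noteq> \<tau>\<^sub>0 \<and> card \<tau> \<le> m. 2 * q ^ card (\<tau>\<^sub>0 - \<tau>)) \<le> 6 * (real p + 1)\<^sup>2 * q"
proof -
  let ?T = "{\<tau>. \<tau> \<subseteq> {1..p} \<and> \<tau> \<noteq> \<tau>\<^sub>0 \<and> card \<tau> \<le> m}"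
  let ?\<phi> = "\<lambda>\<tau>. (\<tau>\<^sub>0 - \<tau>, \<tau> - \<tau>\<^sub>0)"
  let ?P = "(Pow \<tau>\<^sub>0 - {{}}) \<times> Pow ({1..p} - \<tau>\<^sub>0)"
  define y where "y = real p * q"
  have q0: "0 < q" by (simp add: q_def)
  have p: "1 \<le> real p" using m_pos m_le by linarith
  have "q ^ card (\<tau>\<^sub>0 - \<tau>) \<le> y ^ card (\<tau>\<^sub>0 - \<tau>) * (1 / real p) ^ card (\<tau> - \<tau>\<^sub>0)" if "\<tau> \<in> ?T" for \<tau>
  proof -
    have "finite \<tau>" using that finite_model by blast
    from card_model[OF this] have "card (\<tau> - \<tau>\<^sub>0) \<le> card (\<tau>\<^sub>0 - \<tau>)" using that by auto
    then have "real p ^ card (\<tau> - \<tau>\<^sub>0) \<le> real p ^ card (\<tau>\<^sub>0 - \<tau>)" using p by (rule power_increasing)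
    then have "1 \<le> real p ^ card (\<tau>\<^sub>0 - \<tau>) * (1 / real p) ^ card (\<tau> - \<tau>\<^sub>0)"
      using p by (simp add: power_divide le_divide_eq)
    from mult_left_mono[OF this, of "q ^ card (\<tau>\<^sub>0 - \<tau>)"] show ?thesis
      using q0 by (simp add: y_def power_mult_distrib mult_ac)
  qed
  then have "(\<Sum>\<tau>\<in>?T. 2 * q ^ card (\<tau>\<^sub>0 - \<tau>))
      \<le> (\<Sum>\<tau>\<in>?T. 2 * (y ^ card (\<tau>\<^sub>0 - \<tau>) * (1 / real p) ^ card (\<tau> - \<tau>\<^sub>0)))"
    by (intro sum_mono) auto
  also have "\<dots> = (\<Sum>(A, B)\<in>?\<phi> ` ?T. 2 * (y ^ card A * (1 / real p) ^ card B))"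
  proof (subst sum.reindex)
    show "inj_on ?\<phi> ?T"
    proof (rule inj_onI)
      fix \<tau> \<tau>' assume "?\<phi> \<tau> = ?\<phi> \<tau>'"
      moreover have "\<tau> = (\<tau> - \<tau>\<^sub>0) \<union> (\<tau>\<^sub>0 - (\<tau>\<^sub>0 - \<tau>))" for \<tau> by blast
      ultimately show "\<tau> = \<tau>'" by (metis prod.inject)
    qed
  qed simp
  also have "\<dots> \<le> (\<Sum>(A, B)\<in>?P. 2 * (y ^ card A * (1 / real p) ^ card B))"
  proof (intro sum_mono2)
    show "finite ?P" using finite_\<tau>\<^sub>0 by simp
    show "?\<phi> ` ?T \<subseteq> ?P"
    proof (rule image_subsetI)
      fix \<tau> assume "\<tau> \<in> ?T"
      then have "0 < card (\<tau>\<^sub>0 - \<tau>)" using card_missing_pos[of \<tau>] finite_model[of \<tau>] by auto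
      then have "\<tau>\<^sub>0 - \<tau> \<noteq> {}" by (metis card.empty less_irrefl)
      then show "?\<phi> \<tau> \<in> ?P" using \<open>\<tau> \<in> ?T\<close> by auto
    qed
  qed (use q0 p in \<open>auto simp: y_def\<close>)
  also have "\<dots> = 2 * ((\<Sum>A\<in>Pow \<tau>\<^sub>0 - {{}}. y ^ card A) * (\<Sum>B\<in>Pow ({1..p} - \<tau>\<^sub>0). (1 / real p) ^ card B))"
    unfolding sum_product sum.cartesian_product sum_distrib_left[of 2] by (simp only: split_def)
  also have "\<dots> = 2 * (((1 + y) ^ m - 1) * (1 + 1 / real p) ^ (p - m))"
    using finite_\<tau>\<^sub>0 \<tau>\<^sub>0(1) by (simp add: sum_Pow_power_nonempty sum_Pow_power card_Diff_subset)
  \<comment> \<open>From \<open>1 + y \<le> exp y\<close> and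
    \<open>exp z \<le> 1 + z + z\<^sup>2\<close> with \<open>z = m * y \<le> 1/6\<close>, so that
    \<open>z\<^sup>2 \<le> z / 6\<close>.\<close>
  also have "\<dots> \<le> 2 * ((3/2 * (real m * y)) * (1 + 1 / real p) ^ (p - m))"
  proof -
    have "real m * y \<le> real p * (real p * q)" unfolding y_def using m_le q0 p
      by (intro mult_right_mono) auto
    also have "\<dots> \<le> (real p + 1)\<^sup>2 * q" using q0 by (simp add: power2_eq_square algebra_simps)
    finally have my: "real m * y \<le> 1/6" using q by simp
    have my0: "0 \<le> real m * y" using p q0 by (simp add: y_def)
    have "(1 + y) ^ m \<le> exp y ^ m" using p q0 by (intro power_mono exp_ge_add_one_self) (auto simp: y_def)
    also have "\<dots> = exp (real m * y)" by (simp add: exp_of_nat_mult)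
    also have "\<dots> \<le> 1 + real m * y + (real m * y)\<^sup>2" using my my0 by (intro exp_bound) auto
    also have "(real m * y)\<^sup>2 \<le> 1/6 * (real m * y)"
      unfolding power2_eq_square using my my0 by (intro mult_right_mono) auto
    finally have "(1 + y) ^ m - 1 \<le> 3/2 * (real m * y)" using my0 by linarith
    moreover have "0 \<le> (1 + 1 / real p) ^ (p - m)" by simp
    ultimately have "((1 + y) ^ m - 1) * (1 + 1 / real p) ^ (p - m)
        \<le> 3/2 * (real m * y) * (1 + 1 / real p) ^ (p - m)" by (rule mult_right_mono)
    then show ?thesis by (rule mult_left_mono) simp
  qed
  also have "\<dots> = 3 * y * (real m * (1 + 1 / real p) ^ (p - m))" by simp
  \<comment> \<open>Bernoulli gives \<open>m / p \<le> (1 - 1/p) ^ (p - m)\<close>; times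
    \<open>(1 + 1/p) ^ (p - m)\<close> the right side is at most 1.\<close>
  also have "\<dots> \<le> 3 * y * real p"
  proof (rule mult_left_mono)
    have "real m / real p = 1 + real (p - m) * (- 1 / real p)"
      using m_le p by (simp add: of_nat_diff field_simps)
    also have "\<dots> \<le> (1 + - 1 / real p) ^ (p - m)" using p by (intro Bernoulli_inequality) (simp add: field_simps)
    finally have "real m \<le> real p * (1 - 1 / real p) ^ (p - m)" using p by (simp add: field_simps)
    then have "real m * (1 + 1 / real p) ^ (p - m)
       \<le> real p * (1 - 1 / real p) ^ (p - m) * (1 + 1 / real p) ^ (p - m)"
      using p by (intro mult_right_mono) auto
    also have "\<dots> = real p * ((1 - 1 / real p) * (1 + 1 / real p)) ^ (p - m)"
      by (simp only: power_mult_distrib mult.assoc)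
    also have "\<dots> \<le> real p * 1"
    proof (intro mult_left_mono power_le_one)
      show "0 \<le> (1 - 1 / real p) * (1 + 1 / real p)" using p by (intro mult_nonneg_nonneg) auto
      show "(1 - 1 / real p) * (1 + 1 / real p) \<le> 1" by (simp add: algebra_simps)
    qed simp
    finally show "real m * (1 + 1 / real p) ^ (p - m) \<le> real p" by simp
  qed (use q0 p in \<open>simp add: y_def\<close>)
  also have "\<dots> \<le> 6 * (real p + 1)\<^sup>2 * q"
    using q0 by (simp add: y_def power2_eq_square algebra_simps)
  finally show ?thesis .
qed

section \<open>Models larger than the true one\<close>

lemma prob_chi_large:
  assumes J: "J \<subseteq> {1..p} - \<tau>\<^sub>0" "J \<noteq> {}"
  shows "measure N {U \<in> space N. lam * real (max 1 (card J - m)) \<le> \<sigma>\<^sub>0\<^sup>2 * chi u J U}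
           \<le> (7 / (real p)\<^sup>2) ^ card J * exp (- (real n * t / (3 * \<sigma>\<^sub>0\<^sup>2)))"
proof -
  have fin: "finite J" using J(1) finite_subset by blast
  define j where "j = card J"
  \<comment> \<open>A lower bound for the excess \<open>card \<tau> - m\<close> of any larger model
    with \<open>\<tau> - \<tau>\<^sub>0 = J\<close>.\<close>
  define d where "d = max 1 (j - m)"
  have j: "1 \<le> j" using J(2) fin by (simp add: j_def card_gt_0_iff Suc_le_eq)
  \<comment> \<open>\<open>\<tau>\<^sub>0\<close> and \<open>J\<close> are disjoint and nonempty, so
    \<open>p \<ge> 2\<close> and \<open>ln (real p / 2)\<close> is nonnegative.\<close>
  have "m + j = card (\<tau>\<^sub>0 \<union> J)"
    unfolding j_def using J(1) fin finite_\<tau>\<^sub>0 by (subst card_Un_disjoint) auto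
  also have "\<dots> \<le> card {1..p}" using J(1) \<tau>\<^sub>0(1) by (intro card_mono) auto
  finally have p: "2 \<le> p" using m_pos j by simp
  have d: "1 \<le> d" "j \<le> d * (m + 1)"
  proof -
    show "1 \<le> d" by (simp add: d_def)
    show "j \<le> d * (m + 1)"
    proof (cases "j \<le> m")
      case True
      then show ?thesis by (simp add: d_def)
    next
      case False
      then have "d + m = j" "1 \<le> d" by (auto simp: d_def)
      moreover have "1 * m \<le> d * m" using \<open>1 \<le> d\<close> by (intro mult_right_mono) auto
      moreover have "d * (m + 1) = d * m + d" by simp
      ultimately show ?thesis by linarith
    qed
  qed
  define L where "L = ln (real p / 2)"
  have L: "0 \<le> L" using p by (simp add: L_def)
  \<comment> \<open>As \<open>j \<le> d * (m + 1)\<close>, the factor \<open>m + 1\<close> in the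
    lower bound on \<open>lam\<close> pays \<open>2 * L\<close> for each of the \<open>j\<close>
    extra columns. The term with \<open>t\<close> is paid once, as \<open>d \<ge> 1\<close>.\<close>
  have ge: "2 * real j * L + real n * t / (3 * \<sigma>\<^sub>0\<^sup>2) \<le> lam * real d / (3 * \<sigma>\<^sub>0\<^sup>2)"
  proof -
    have "real j \<le> real d * (real m + 1)"
      using of_nat_mono[OF d(2), where 'a = real] by (simp add: algebra_simps)
    then have "2 * real j * L \<le> 2 * (real d * (real m + 1)) * L"
      using L by (intro mult_right_mono mult_left_mono) simp_all
    moreover have "real n * t / (3 * \<sigma>\<^sub>0\<^sup>2) * 1 \<le> real n * t / (3 * \<sigma>\<^sub>0\<^sup>2) * real d"
      using d(1) t by (intro mult_left_mono) auto
    moreover have "(6 * \<sigma>\<^sub>0\<^sup>2 * (real m + 1) * L + real n * t) * real d / (3 * \<sigma>\<^sub>0\<^sup>2)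
        = 2 * (real d * (real m + 1)) * L + real n * t / (3 * \<sigma>\<^sub>0\<^sup>2) * real d"
      using \<sigma>\<^sub>0 by (simp add: field_simps)
    ultimately have "2 * real j * L + real n * t / (3 * \<sigma>\<^sub>0\<^sup>2)
        \<le> (6 * \<sigma>\<^sub>0\<^sup>2 * (real m + 1) * L + real n * t) * real d / (3 * \<sigma>\<^sub>0\<^sup>2)"
      by linarith
    also have "\<dots> \<le> lam * real d / (3 * \<sigma>\<^sub>0\<^sup>2)"
      using lam_ge by (intro divide_right_mono mult_right_mono) (auto simp: L_def)
    finally show ?thesis .
  qed
  have "{U \<in> space N. lam * real d \<le> \<sigma>\<^sub>0\<^sup>2 * chi u J U} = {U \<in> space N. lam * real d / \<sigma>\<^sub>0\<^sup>2 \<le> chi u J U}"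
    using \<sigma>\<^sub>0 by (simp add: field_simps)
  also have "measure N \<dots> \<le> sqrt 3 ^ j * exp (- (lam * real d / \<sigma>\<^sub>0\<^sup>2) / 3)"
    unfolding chi_def j_def by (intro chi_square_tail subon_ext_basis fin)
  also have "\<dots> \<le> sqrt 3 ^ j * exp (- (2 * real j * L + real n * t / (3 * \<sigma>\<^sub>0\<^sup>2)))"
    using ge by (intro mult_left_mono) (auto simp: field_simps)
  also have "\<dots> = (sqrt 3 * exp (- 2 * L)) ^ j * exp (- (real n * t / (3 * \<sigma>\<^sub>0\<^sup>2)))"
    by (simp add: power_mult_distrib exp_of_nat_mult[symmetric] mult_exp_exp mult_ac)
  \<comment> \<open>\<open>exp (- 2 * L)\<close> is \<open>4 / p\<^sup>2\<close>, and 7 bounds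
    \<open>4 * sqrt 3\<close>.\<close>
  also have "\<dots> \<le> (7 / (real p)\<^sup>2) ^ j * exp (- (real n * t / (3 * \<sigma>\<^sub>0\<^sup>2)))"
  proof (intro mult_right_mono power_mono)
    have "exp (- 2 * L) = exp (- L) ^ 2" by (simp add: exp_of_nat_mult[symmetric])
    also have "exp (- L) = 2 / real p" using p by (simp add: L_def exp_minus)
    finally have e: "exp (- 2 * L) = 4 / (real p)\<^sup>2" by (simp add: power_divide)
    have "sqrt 3 \<le> 7/4" by (rule real_le_lsqrt) (auto simp: power2_eq_square)
    then have "sqrt 3 * (4 / (real p)\<^sup>2) \<le> 7/4 * (4 / (real p)\<^sup>2)" by (intro mult_right_mono) auto
    then show "sqrt 3 * exp (- 2 * L) \<le> 7 / (real p)\<^sup>2" unfolding e by simp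
  qed auto
  finally show ?thesis by (simp add: j_def d_def)
qed

text \<open>For \<open>p \<ge> 4\<close> the power is at most
  \<open>exp (7 * (p - 1) / p\<^sup>2)\<close>, with exponent at most \<open>4/3\<close>; smaller
  \<open>p\<close> are computed directly. Removing the empty \<open>J\<close> from the sum later
  turns 4 into the constant 3 of the theorem.\<close>

lemma power_bound_large: "(1 + 7 / (real p)\<^sup>2) ^ (p - m) \<le> 4"
proof -
  have "(1 + 7 / (real p)\<^sup>2) ^ (p - m) \<le> (1 + 7 / (real p)\<^sup>2) ^ (p - 1)"
    using m_pos by (intro power_increasing) auto
  also have "\<dots> \<le> 4"
  proof -
    consider "p \<le> 1" | "p = 2" | "p = 3" | "4 \<le> p" by linarith
    then show ?thesis
    proof cases
      case 4
      have "(1 + 7 / (real p)\<^sup>2) ^ (p - 1) \<le> exp (7 / (real p)\<^sup>2) ^ (p - 1)"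
        by (intro power_mono exp_ge_add_one_self) auto
      also have "\<dots> = exp (real (p - 1) * (7 / (real p)\<^sup>2))" by (simp only: exp_of_nat_mult)
      also have "\<dots> \<le> exp (4/3)"
      proof -
        \<comment> \<open>\<open>4 * p\<^sup>2 - 21 * (p - 1)\<close> equals
          \<open>(p - 4) * (4 * p - 5) + 1\<close>.\<close>
        have "0 \<le> (real p - 4) * (4 * real p - 5) + 1" using 4 by (intro add_nonneg_nonneg mult_nonneg_nonneg) auto
        then have "real (p - 1) * 21 \<le> 4 * (real p)\<^sup>2"
          using 4 by (simp add: of_nat_diff power2_eq_square algebra_simps)
        then show ?thesis using 4 by (simp add: field_simps)
      qed
      also have "\<dots> \<le> 4"
      proof (rule power_le_imp_le_base)
        have "exp (4/3 :: real) ^ 3 = exp 1 ^ 4" by (simp flip: exp_of_nat_mult)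
        also have "\<dots> \<le> (272/100) ^ 4" using e_less_272 by (intro power_mono) auto
        also have "\<dots> \<le> 4 ^ 3" by (simp add: power_divide)
        finally show "exp (4/3 :: real) ^ Suc 2 \<le> 4 ^ Suc 2" by (simp only: numeral_3_eq_3 numeral_2_eq_2)
      qed simp
      finally show ?thesis .
    qed (simp_all add: power2_eq_square)
  qed
  finally show ?thesis .
qed

lemma prob_fail_le:
  assumes good: "good u"
  shows "measure N {U \<in> space N. \<exists>\<tau>\<subseteq>{1..p}. \<tau> \<noteq> \<tau>\<^sub>0 \<and> fail u U \<tau>}
           \<le> 6 * (real p + 1)\<^sup>2 * q + 3 * exp (- (real n * t / (3 * \<sigma>\<^sub>0\<^sup>2)))"
    (is "measure N ?F \<le> _")
\<comment> \<open>If this fails, the claimed bound exceeds 1. If it holds, \<open>q\<close> is small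
  enough for the estimate of a single model and for the sum over models.\<close>
proof (cases "6 * (real p + 1)\<^sup>2 * q \<le> 1")
  case False
  interpret N: prob_space N by (rule prob_space_std_normal_vec)
  have "measure N ?F \<le> 1" by simp
  also have "\<dots> \<le> 6 * (real p + 1)\<^sup>2 * q + 3 * exp (- (real n * t / (3 * \<sigma>\<^sub>0\<^sup>2)))"
    using False by (intro add_increasing2) auto
  finally show ?thesis .
next
  case True
  interpret N: prob_space N by (rule prob_space_std_normal_vec)
  define E where "E = exp (- (real n * t / (3 * \<sigma>\<^sub>0\<^sup>2)))"
  have q0: "0 < q" by (simp add: q_def)
  have "1 * 1 \<le> (real p + 1) * (real p + 1)" by (intro mult_mono) auto
  then have "2 * q \<le> 6 * (real p + 1)\<^sup>2 * q" using q0 by (simp add: power2_eq_square)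
  with True have q: "2 * q \<le> 1" by linarith
  let ?T = "{\<tau>. \<tau> \<subseteq> {1..p} \<and> \<tau> \<noteq> \<tau>\<^sub>0 \<and> card \<tau> \<le> m}"
  let ?J = "Pow ({1..p} - \<tau>\<^sub>0) - {{}}"
  define A where "A \<tau> = {U \<in> space N. fail u U \<tau>}" for \<tau>
  define B where "B J = {U \<in> space N. lam * real (max 1 (card J - m)) \<le> \<sigma>\<^sub>0\<^sup>2 * chi u J U}" for J
  have finT: "finite ?T" by (rule finite_subset[of _ "Pow {1..p}"]) auto
  have A_sets: "A \<tau> \<in> sets N" if "\<tau> \<in> ?T" for \<tau>
    using that finite_model[of \<tau>] by (auto simp: A_def intro: sets_fail)
  have B_sets: "B J \<in> sets N" for J unfolding B_def by measurable
  have "?F \<subseteq> (\<Union>\<tau>\<in>?T. A \<tau>) \<union> (\<Union>J\<in>?J. B J)"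
  proof
    fix U assume "U \<in> ?F"
    then obtain \<tau> where U: "U \<in> space N" and \<tau>: "\<tau> \<subseteq> {1..p}" "\<tau> \<noteq> \<tau>\<^sub>0" "fail u U \<tau>" by blast
    show "U \<in> (\<Union>\<tau>\<in>?T. A \<tau>) \<union> (\<Union>J\<in>?J. B J)"
    proof (cases "card \<tau> \<le> m")
      case True
      then show ?thesis using U \<tau> by (auto simp: A_def)
    next
      case False
      have fin: "finite \<tau>" using \<tau>(1) by (rule finite_model)
      have "card (\<tau>\<^sub>0 - \<tau>) \<le> m" by (rule card_mono[OF finite_\<tau>\<^sub>0]) blast
      \<comment> \<open>By \<open>card_model\<close> the excess is \<open>card (\<tau> -
        \<tau>\<^sub>0) - card (\<tau>\<^sub>0 - \<tau>)\<close>, and at most \<open>m\<close>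
        columns can be missing.\<close>
      then have d: "max 1 (card (\<tau> - \<tau>\<^sub>0) - m) \<le> card \<tau> - m"
        using card_model[OF fin] False by linarith
      have "lam * real (max 1 (card (\<tau> - \<tau>\<^sub>0) - m)) \<le> lam * real (card \<tau> - m)"
        by (rule mult_left_mono[OF of_nat_mono[OF d] less_imp_le[OF lam]])
      also have "\<dots> \<le> \<sigma>\<^sub>0\<^sup>2 * chi u (\<tau> - \<tau>\<^sub>0) U"
        using fail_imp_chi[OF fin \<tau>(3)] False by (simp add: of_nat_diff)
      finally have UB: "U \<in> B (\<tau> - \<tau>\<^sub>0)" using U by (simp add: B_def)
      have "\<not> \<tau> \<subseteq> \<tau>\<^sub>0" using False card_mono[OF finite_\<tau>\<^sub>0, of \<tau>] by blast
      then have "\<tau> - \<tau>\<^sub>0 \<in> ?J" using \<tau>(1) by blast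
      from UN_I[where B = B, OF this UB] show ?thesis by (rule UnI2)
    qed
  qed
  then have "measure N ?F \<le> measure N ((\<Union>\<tau>\<in>?T. A \<tau>) \<union> (\<Union>J\<in>?J. B J))"
    using A_sets B_sets finT by (intro N.finite_measure_mono sets.Un sets.finite_UN) auto
  also have "\<dots> \<le> measure N (\<Union>\<tau>\<in>?T. A \<tau>) + measure N (\<Union>J\<in>?J. B J)"
    using A_sets B_sets finT by (intro measure_Un_le sets.finite_UN) auto
  also have "measure N (\<Union>\<tau>\<in>?T. A \<tau>) \<le> (\<Sum>\<tau>\<in>?T. measure N (A \<tau>))"
    using A_sets finT by (intro N.finite_measure_subadditive_finite) auto
  also have "\<dots> \<le> (\<Sum>\<tau>\<in>?T. 2 * q ^ card (\<tau>\<^sub>0 - \<tau>))"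
    unfolding A_def by (intro sum_mono prob_fail_small good q) auto
  also have "\<dots> \<le> 6 * (real p + 1)\<^sup>2 * q" by (rule sum_small_models[OF True])
  also have "measure N (\<Union>J\<in>?J. B J) \<le> (\<Sum>J\<in>?J. measure N (B J))"
    using B_sets by (intro N.finite_measure_subadditive_finite) auto
  also have "\<dots> \<le> (\<Sum>J\<in>?J. (7 / (real p)\<^sup>2) ^ card J * E)"
    unfolding B_def E_def by (intro sum_mono prob_chi_large) auto
  also have "\<dots> = ((1 + 7 / (real p)\<^sup>2) ^ (p - m) - 1) * E"
    using finite_\<tau>\<^sub>0 \<tau>\<^sub>0(1)
    by (simp add: sum_distrib_right[symmetric] sum_Pow_power_nonempty card_Diff_subset)
  also have "\<dots> \<le> 3 * E" using power_bound_large by (intro mult_right_mono) (auto simp: E_def)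
  finally show ?thesis by (simp add: E_def)
qed

end

section \<open>Averaging over the repro noises\<close>

text \<open>Each such set is the image of a function on \<open>{..<m}\<close>; surplus arguments are
  sent to one fixed element, which exists as the set is nonempty.\<close>

lemma card_nonempty_subsets_le:
  fixes A :: "'a set"
  assumes "finite A"
  shows "card {B. B \<subseteq> A \<and> B \<noteq> {} \<and> card B \<le> m} \<le> card A ^ m"
proof -
  let ?F = "{..<m} \<rightarrow>\<^sub>E A"
  have "{B. B \<subseteq> A \<and> B \<noteq> {} \<and> card B \<le> m} \<subseteq> (\<lambda>f. f ` {..<m}) ` ?F"
  proof
    fix B assume "B \<in> {B. B \<subseteq> A \<and> B \<noteq> {} \<and> card B \<le> m}"
    then have B: "B \<subseteq> A" "B \<noteq> {}" "card B \<le> m" by auto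
    have "finite B" using B(1) assms finite_subset by blast
    then have k: "0 < card B" using B(2) by (simp add: card_gt_0_iff)
    obtain g where "bij_betw g {0..<card B} B" using ex_bij_betw_nat_finite[OF \<open>finite B\<close>] by blast
    then have g: "g ` {0..<card B} = B" by (rule bij_betw_imp_surj_on)
    have gB: "g i \<in> B" if "i < card B" for i
      using imageI[of i "{0..<card B}" g] that unfolding g by simp
    define f where "f = restrict (\<lambda>i. if i < card B then g i else g 0) {..<m}"
    have "f ` {..<m} = B"
    proof
      show "f ` {..<m} \<subseteq> B" using gB k by (auto simp: f_def)
      show "B \<subseteq> f ` {..<m}"
      proof
        fix x assume "x \<in> B"
        then have "x \<in> g ` {0..<card B}" by (simp only: g)
        then obtain i where "i < card B" "x = g i" by auto
        then show "x \<in> f ` {..<m}" using B(3) by (intro image_eqI[of _ _ i]) (auto simp: f_def)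
      qed
    qed
    moreover have "f \<in> ?F" using gB k B(1) by (auto simp: f_def)
    ultimately show "B \<in> (\<lambda>f. f ` {..<m}) ` ?F" by blast
  qed
  then have "card {B. B \<subseteq> A \<and> B \<noteq> {} \<and> card B \<le> m} \<le> card ((\<lambda>f. f ` {..<m}) ` ?F)"
    using assms by (intro card_mono finite_imageI finite_PiE) auto
  also have "\<dots> \<le> card ?F" using assms by (intro card_image_le finite_PiE) auto
  also have "\<dots> = card A ^ m" by (simp add: card_PiE)
  finally show ?thesis .
qed

lemma sqd_gs_step_old: "sqd n r (gs_step n r f w) u = sqd n r f u"
  unfolding sqd_def by (intro arg_cong2[of _ _ _ _ "(-)"] refl sum.cong) (simp add: gs_step_old)

section \<open>Bad repro noises\<close>

context repro_setup
begin

definition small_models :: "nat set set" where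
  "small_models = {\<tau>. \<tau> \<subseteq> {1..p} \<and> \<tau> \<noteq> \<tau>\<^sub>0 \<and> card \<tau> \<le> m}"

text \<open>Without division, this says that the residuals of \<open>u\<close> and of the mean on
  the columns of \<tau> have squared cosine at least \<open>7/10\<close>. The basis is built from
  the mean and not from \<open>u\<close>, so both sides are fixed quadratic forms in the Gaussian
  vector \<open>u\<close>.\<close>

definition aligned :: "(nat \<Rightarrow> real) \<Rightarrow> nat set \<Rightarrow> bool" where
  "aligned u \<tau> \<longleftrightarrow> 7/10 * sqd n (card \<tau>) (aug_basis n X \<tau> \<mu>) u
                    \<le> (ip n (aug_basis n X \<tau> \<mu> (card \<tau>)) u)\<^sup>2"

lemma finite_small_models: "finite small_models"
  by (rule finite_subset[of _ "Pow {1..p}"]) (auto simp: small_models_def)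

text \<open>The empty model is included but \<open>\<tau>\<^sub>0\<close> is not; exchanging the two
  compares with the nonempty sets of size at most \<open>m\<close>.\<close>

lemma card_small_models: "card small_models \<le> p ^ m"
proof -
  let ?F = "{\<tau>. \<tau> \<subseteq> {1..p} \<and> \<tau> \<noteq> {} \<and> card \<tau> \<le> m}"
  have fin: "finite ?F" by (rule finite_subset[of _ "Pow {1..p}"]) auto
  have mem: "\<tau>\<^sub>0 \<in> ?F" using \<tau>\<^sub>0 by simp
  have "card small_models \<le> card (insert {} (?F - {\<tau>\<^sub>0}))"
    using fin by (intro card_mono) (auto simp: small_models_def)
  also have "\<dots> = Suc (card (?F - {\<tau>\<^sub>0}))" using fin by (intro card_insert_disjoint) auto
  also have "\<dots> = card ?F" using fin mem by (rule card.remove[symmetric])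
  also have "\<dots> \<le> p ^ m" using card_nonempty_subsets_le[of "{1..p}" m] by simp
  finally show ?thesis .
qed

lemma good_if_not_aligned:
  assumes "\<And>\<tau>. \<tau> \<in> small_models \<Longrightarrow> \<not> aligned u \<tau>"
  shows "good u"
  unfolding good_def
proof (intro allI impI)
  fix \<tau> \<beta> \<sigma> assume \<tau>: "\<tau> \<subseteq> {1..p}" "\<tau> \<noteq> \<tau>\<^sub>0" "card \<tau> \<le> m"
  have "\<not> aligned u \<tau>" using assms \<tau> by (simp add: small_models_def)
  then have angle: "(ip n (aug_basis n X \<tau> \<mu> (card \<tau>)) u)\<^sup>2 \<le> 7/10 * sqd n (card \<tau>) (model_basis n X \<tau>) u"
    unfolding aligned_def by (simp add: aug_basis_def sqd_gs_step_old)
  show "3/10 * (D * real (card (\<tau>\<^sub>0 - \<tau>))) \<le> norm2_sq n (\<lambda>i. \<mu> i - lin X \<tau> \<beta> i - \<sigma> * u i)"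
    using norm_ge_of_angle[OF finite_model[OF \<tau>(1)] angle C_min_le[OF n \<tau>\<^sub>0(1) \<tau>]] .
qed

lemma measurable_sqd [measurable]: "(\<lambda>u. sqd n r f u) \<in> borel_measurable N"
  unfolding sqd_def using measurable_std_normal_vec_component by measurable

lemma sets_aligned: "{u \<in> space N. aligned u \<tau>} \<in> sets N"
  unfolding aligned_def by measurable

lemma sets_ex_aligned: "{u \<in> space N. \<exists>\<tau>\<in>small_models. aligned u \<tau>} \<in> sets N"
proof -
  have "{u \<in> space N. \<exists>\<tau>\<in>small_models. aligned u \<tau>} = (\<Union>\<tau>\<in>small_models. {u \<in> space N. aligned u \<tau>})"
    by blast
  then show ?thesis using finite_small_models sets_aligned by (simp add: sets.finite_UN)
qed

text \<open>The base \<open>11/4\<close> of \<open>angle_tail\<close> is lowered to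
  \<open>exp 1\<close>, and \<open>sqrt 11 \<le> 5 \<le> exp 2\<close> gives the 2 in the
  exponent.\<close>

lemma prob_aligned:
  assumes "m \<le> n" "card \<tau> \<le> m" "finite \<tau>"
  shows "measure N {u \<in> space N. aligned u \<tau>} \<le> exp (2 - (real n - real m) / 2)"
proof -
  define s where "s = sqrt (11/4 :: real)"
  have s: "exp (1/2) \<le> s"
    unfolding s_def
  proof (rule real_le_rsqrt)
    have "(exp (1/2 :: real))\<^sup>2 = exp 1" by (simp flip: exp_of_nat_mult)
    then show "(exp (1/2))\<^sup>2 \<le> (11/4 :: real)" using e_less_272 by simp
  qed
  have s1: "1 \<le> s" using s exp_ge_add_one_self[of "1/2"] by linarith
  have "measure N {u \<in> space N. aligned u \<tau>} \<le> sqrt 11 * s ^ card \<tau> / s ^ n"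
    unfolding aligned_def s_def by (intro angle_tail subon_aug_basis assms(3))
  also have "\<dots> \<le> sqrt 11 * s ^ m / s ^ n"
    using s1 assms(2) by (intro divide_right_mono mult_left_mono power_increasing) auto
  also have "\<dots> = sqrt 11 / s ^ (n - m)"
    using s1 assms(1) by (simp add: power_diff)
  also have "\<dots> \<le> sqrt 11 / exp (1/2) ^ (n - m)"
    using s s1 by (intro divide_left_mono power_mono) auto
  also have "\<dots> \<le> exp 2 / exp (1/2) ^ (n - m)"
  proof (intro divide_right_mono)
    have "sqrt 11 \<le> (5 :: real)" by (rule real_le_lsqrt) auto
    also have "\<dots> \<le> exp 2" using exp_lower_Taylor_quadratic[of 2] by simp
    finally show "sqrt 11 \<le> exp (2 :: real)" .
  qed auto
  also have "\<dots> = exp (2 - (real n - real m) / 2)"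
    using assms(1) by (simp add: exp_of_nat_mult[symmetric] exp_diff[symmetric] of_nat_diff)
  finally show ?thesis .
qed

lemma prob_ex_aligned:
  assumes "m \<le> n"
  shows "measure N {u \<in> space N. \<exists>\<tau>\<in>small_models. aligned u \<tau>}
           \<le> exp (real m * ln (real p) + 2 - (real n - real m) / 2)"
proof -
  interpret N: prob_space N by (rule prob_space_std_normal_vec)
  have p: "0 < p" using m_pos m_le by linarith
  have "{u \<in> space N. \<exists>\<tau>\<in>small_models. aligned u \<tau>} = (\<Union>\<tau>\<in>small_models. {u \<in> space N. aligned u \<tau>})"
    by blast
  then have "measure N {u \<in> space N. \<exists>\<tau>\<in>small_models. aligned u \<tau>}
     \<le> (\<Sum>\<tau>\<in>small_models. measure N {u \<in> space N. aligned u \<tau>})"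
    using sets_aligned by (auto intro!: N.finite_measure_subadditive_finite finite_small_models)
  also have "\<dots> \<le> (\<Sum>\<tau>\<in>small_models. exp (2 - (real n - real m) / 2))"
    using assms finite_model by (intro sum_mono prob_aligned) (auto simp: small_models_def)
  also have "\<dots> = real (card small_models) * exp (2 - (real n - real m) / 2)" by simp
  also have "\<dots> \<le> real (p ^ m) * exp (2 - (real n - real m) / 2)"
    using card_small_models by (intro mult_right_mono of_nat_mono) auto
  also have "real (p ^ m) = exp (real m * ln (real p))" using p by (simp add: exp_of_nat_mult)
  also have "exp (real m * ln (real p)) * exp (2 - (real n - real m) / 2)
      = exp (real m * ln (real p) + 2 - (real n - real m) / 2)"
    by (simp add: mult_exp_exp add_diff_eq)
  finally show ?thesis .
qed

section \<open>Conditioning on the repro noises\<close>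

definition bound :: real where
  "bound = 6 * (real p + 1)\<^sup>2 * q + 3 * exp (- (real n * t / (3 * \<sigma>\<^sub>0\<^sup>2)))"

text \<open>Coordinate 0 of the product holds \<open>U\<close>, the others the repro noises. Fubini
  fixes the latter: if all are bad, the inner integral is at most 1, and otherwise a single good one
  already bounds it by \<open>bound\<close>. The product measure of the all-bad event is a
  \<open>d\<close>-th power.\<close>

lemma prob_all_fail:
  assumes d: "1 \<le> d"
  defines "K \<equiv> \<Pi>\<^sub>M b\<in>{0..d}. N"
  defines "W \<equiv> {x \<in> space K. \<forall>b\<in>{1..d}. \<exists>\<tau>\<in>Pow {1..p} - {\<tau>\<^sub>0}. fail (x b) (x 0) \<tau>}"
  shows "W \<in> sets K"
    and "measure K W \<le> measure N {u \<in> space N. \<exists>\<tau>\<in>small_models. aligned u \<tau>} ^ d + bound"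
proof -
  interpret N: prob_space N by (rule prob_space_std_normal_vec)
  interpret PN: product_prob_space "\<lambda>_ :: nat. N" UNIV
    by (rule product_prob_spaceI) (rule prob_space_std_normal_vec)
  interpret K: prob_space K unfolding K_def by (intro prob_space_PiM prob_space_std_normal_vec)
  have comp: "(\<lambda>x. x b i) \<in> borel_measurable K" if "b \<in> {0..d}" "i \<in> {1..n}" for b i
    using measurable_compose[OF measurable_component_singleton[OF that(1), of "\<lambda>_. N"]
        measurable_std_normal_vec_component[OF that(2)]] by (simp add: K_def)
  have resp: "(\<lambda>x. response X \<tau>\<^sub>0 \<beta>\<^sub>0 \<sigma>\<^sub>0 (x 0) i) \<in> borel_measurable K" if "i \<in> {1..n}" for i
    unfolding response_def using comp[OF _ that, of 0]
    by (intro borel_measurable_add borel_measurable_times borel_measurable_const) auto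
  have crit: "(\<lambda>x. criterion n X lam (response X \<tau>\<^sub>0 \<beta>\<^sub>0 \<sigma>\<^sub>0 (x 0)) (x b) \<tau>) \<in> borel_measurable K"
    if "b \<in> {1..d}" "finite \<tau>" for b \<tau>
    using that(2) by (rule measurable_criterion) (use resp comp[of b] that(1) in auto)
  have fail_sets: "{x \<in> space K. fail (x b) (x 0) \<tau>} \<in> sets K"
    if "b \<in> {1..d}" "\<tau> \<in> Pow {1..p} - {\<tau>\<^sub>0}" for b \<tau>
    unfolding fail_def using crit[OF that(1) finite_\<tau>\<^sub>0] crit[OF that(1), of \<tau>] that(2) finite_model[of \<tau>]
    by (intro borel_measurable_le) auto
  have W_eq: "W = (\<Inter>b\<in>{1..d}. \<Union>\<tau>\<in>Pow {1..p} - {\<tau>\<^sub>0}. {x \<in> space K. fail (x b) (x 0) \<tau>})"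
    using d by (auto simp: W_def)
  show W: "W \<in> sets K"
    unfolding W_eq using d fail_sets by (intro sets.finite_INT sets.finite_UN) auto
  let ?B = "{u \<in> space N. \<exists>\<tau>\<in>small_models. aligned u \<tau>}"
  let ?L = "\<Pi>\<^sub>M b\<in>{1..d}. N"
  have ins: "insert 0 {1..d} = {0..d}" by auto
  have bound0: "0 \<le> bound" by (simp add: bound_def q_def)
  have "emeasure K W = (\<integral>\<^sup>+x. indicator W x \<partial>K)" using W by simp
  also have "\<dots> = (\<integral>\<^sup>+x. (\<integral>\<^sup>+y. indicator W (x(0 := y)) \<partial>N) \<partial>?L)"
    using PN.product_nn_integral_insert[of "{1..d}" 0 "indicator W"] W
    unfolding ins K_def[symmetric] by simp
  also have "\<dots> \<le> (\<integral>\<^sup>+x. indicator (\<Pi>\<^sub>E b\<in>{1..d}. ?B) x + ennreal bound \<partial>?L)"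
  proof (rule nn_integral_mono)
    fix x assume x: "x \<in> space ?L"
    show "(\<integral>\<^sup>+y. indicator W (x(0 := y)) \<partial>N) \<le> indicator (\<Pi>\<^sub>E b\<in>{1..d}. ?B) x + ennreal bound"
    proof (cases "x \<in> (\<Pi>\<^sub>E b\<in>{1..d}. ?B)")
      case True
      have "(\<integral>\<^sup>+y. indicator W (x(0 := y)) \<partial>N) \<le> (\<integral>\<^sup>+y. 1 \<partial>N)"
        by (intro nn_integral_mono) (auto simp: indicator_def)
      also have "\<dots> = 1" by (simp add: N.emeasure_space_1)
      also have "\<dots> \<le> indicator (\<Pi>\<^sub>E b\<in>{1..d}. ?B) x + ennreal bound" using True by simp
      finally show ?thesis .
    next
      case False
      then obtain b where b: "b \<in> {1..d}" "x b \<in> space N" "\<forall>\<tau>\<in>small_models. \<not> aligned (x b) \<tau>"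
        using x by (auto simp: space_PiM PiE_def Pi_def)
      have good: "good (x b)" using b(3) by (intro good_if_not_aligned) auto
      let ?F = "{U \<in> space N. \<exists>\<tau>\<subseteq>{1..p}. \<tau> \<noteq> \<tau>\<^sub>0 \<and> fail (x b) U \<tau>}"
      have F_eq: "?F = (\<Union>\<tau>\<in>Pow {1..p} - {\<tau>\<^sub>0}. {U \<in> space N. fail (x b) U \<tau>})" by blast
      have "{U \<in> space N. fail (x b) U \<tau>} \<in> sets N" if "\<tau> \<in> Pow {1..p} - {\<tau>\<^sub>0}" for \<tau>
        by (intro sets_fail finite_model) (use that in blast)
      then have F: "?F \<in> sets N" unfolding F_eq by (intro sets.finite_UN finite_Diff) simp_all
      have "(\<integral>\<^sup>+y. indicator W (x(0 := y)) \<partial>N) \<le> (\<integral>\<^sup>+y. indicator ?F y \<partial>N)"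
      proof (rule nn_integral_mono)
        fix y assume y: "y \<in> space N"
        have "y \<in> ?F" if w: "x(0 := y) \<in> W"
        proof -
          have "\<exists>\<tau>\<in>Pow {1..p} - {\<tau>\<^sub>0}. fail ((x(0 := y)) b) ((x(0 := y)) 0) \<tau>"
            using w b(1) unfolding W_def by blast
          moreover have "b \<noteq> 0" using b(1) by simp
          ultimately show ?thesis using y by auto
        qed
        then show "(indicator W (x(0 := y)) :: ennreal) \<le> indicator ?F y"
          by (auto simp: indicator_def)
      qed
      also have "\<dots> = ennreal (measure N ?F)" using F by (simp add: N.emeasure_eq_measure)
      also have "\<dots> \<le> ennreal bound"
        unfolding bound_def by (intro ennreal_leI prob_fail_le good)
      also have "\<dots> \<le> indicator (\<Pi>\<^sub>E b\<in>{1..d}. ?B) x + ennreal bound" by simp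
      finally show ?thesis .
    qed
  qed
  also have "\<dots> = emeasure ?L (\<Pi>\<^sub>E b\<in>{1..d}. ?B) + ennreal bound"
  proof -
    interpret L: prob_space ?L by (intro prob_space_PiM prob_space_std_normal_vec)
    have "(\<Pi>\<^sub>E b\<in>{1..d}. ?B) \<in> sets ?L" using sets_ex_aligned by (intro sets_PiM_I_finite) auto
    then show ?thesis using L.emeasure_space_1 by (subst nn_integral_add) auto
  qed
  also have "emeasure ?L (\<Pi>\<^sub>E b\<in>{1..d}. ?B) = (\<Prod>b\<in>{1..d}. emeasure N ?B)"
    using sets_ex_aligned by (intro PN.emeasure_PiM) auto
  also have "\<dots> = ennreal (measure N ?B ^ d)"
    by (simp add: N.emeasure_eq_measure ennreal_power)
  also have "ennreal (measure N ?B ^ d) + ennreal bound = ennreal (measure N ?B ^ d + bound)"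
    using bound0 by (simp add: ennreal_plus)
  finally have "ennreal (measure K W) \<le> ennreal (measure N ?B ^ d + bound)"
    by (simp add: K.emeasure_eq_measure)
  then show "measure K W \<le> measure N ?B ^ d + bound"
    using bound0 by (subst (asm) ennreal_le_iff) auto
qed

lemma miss_prob_le:
  assumes d: "1 \<le> d" and tb: "tie_breaking tb" and noise: "gaussian_noise M n d U Ustar" and "m \<le> n"
  shows "miss_prob M tb d U Ustar n p X \<tau>\<^sub>0 \<beta>\<^sub>0 \<sigma>\<^sub>0 lam
           \<le> bound + exp (real m * ln (real p) + 2 - (real n - real m) / 2) ^ d"
proof -
  interpret M: prob_space M using noise by (simp add: gaussian_noise_def)
  let ?X = "\<lambda>b. if b = 0 then U else Ustar b"
  define K where "K = (\<Pi>\<^sub>M b\<in>{0..d}. N)"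
  define W where "W = {x \<in> space K. \<forall>b\<in>{1..d}. \<exists>\<tau>\<in>Pow {1..p} - {\<tau>\<^sub>0}. fail (x b) (x 0) \<tau>}"
  note W_sets = prob_all_fail(1)[OF d, folded K_def, folded W_def]
  note W_le = prob_all_fail(2)[OF d, folded K_def, folded W_def]
  let ?Y = "\<lambda>\<omega>. \<lambda>b\<in>{0..d}. ?X b \<omega>"
  have indep: "M.indep_vars (\<lambda>_. N) ?X {0..d}" using noise by (simp add: gaussian_noise_def)
  have rv: "?X b \<in> measurable M N" if "b \<in> {0..d}" for b
    using indep that unfolding M.indep_vars_def by blast
  have Y: "?Y \<in> measurable M K" unfolding K_def by (intro measurable_restrict rv)
  \<comment> \<open>Independence and the marginal laws identify the joint law of \<open>U\<close>
    and the repro noises with \<open>K\<close>.\<close>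
  have "distr M K ?Y = (\<Pi>\<^sub>M b\<in>{0..d}. distr M N (?X b))"
    using M.indep_vars_iff_distr_eq_PiM'[where I = "{0..d}" and M' = "\<lambda>_. N" and X = ?X] rv indep
    unfolding K_def by auto
  also have "\<dots> = K"
    unfolding K_def using noise by (intro PiM_cong) (auto simp: gaussian_noise_def)
  finally have distr: "distr M K ?Y = K" .
  let ?E = "{\<omega> \<in> space M. \<tau>\<^sub>0 \<notin> candidate_set tb d n p X lam
               (response X \<tau>\<^sub>0 \<beta>\<^sub>0 \<sigma>\<^sub>0 (U \<omega>)) (\<lambda>b. Ustar b \<omega>)}"
  \<comment> \<open>Inclusion in a measurable event suffices: \<open>tau_hat\<close> is a minimiser,
    so if it differs from \<open>\<tau>\<^sub>0\<close> it is itself a model for which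
    \<open>fail\<close> holds.\<close>
  have "?E \<subseteq> ?Y -` W \<inter> space M"
  proof
    fix \<omega> assume \<omega>: "\<omega> \<in> ?E"
    have "\<exists>\<tau>\<in>Pow {1..p} - {\<tau>\<^sub>0}. fail (Ustar b \<omega>) (U \<omega>) \<tau>" if b: "b \<in> {1..d}" for b
    proof -
      let ?c = "criterion n X lam (response X \<tau>\<^sub>0 \<beta>\<^sub>0 \<sigma>\<^sub>0 (U \<omega>)) (Ustar b \<omega>)"
      define S where "S = {\<tau>. is_arg_min ?c (\<lambda>\<tau>. \<tau> \<subseteq> {1..p}) \<tau>}"
      define \<tau> where "\<tau> = tb S"
      have "\<exists>\<tau>. is_arg_min ?c (\<lambda>\<tau>. \<tau> \<in> Pow {1..p}) \<tau>" by (rule ex_is_arg_min_if_finite) auto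
      then have "S \<noteq> {}" unfolding S_def Pow_iff Collect_empty_eq by (simp only: not_all not_not)
      then have "\<tau> \<in> S" unfolding \<tau>_def by (rule tb[unfolded tie_breaking_def, rule_format])
      then have \<tau>: "\<tau> \<subseteq> {1..p}" "?c \<tau> \<le> ?c \<tau>\<^sub>0"
        using \<tau>\<^sub>0(1) unfolding S_def mem_Collect_eq is_arg_min_linorder by blast+
      have "tau_hat tb n p X lam (response X \<tau>\<^sub>0 \<beta>\<^sub>0 \<sigma>\<^sub>0 (U \<omega>)) (Ustar b \<omega>) \<noteq> \<tau>\<^sub>0"
        using \<omega> b unfolding candidate_set_def by blast
      then have "\<tau> \<noteq> \<tau>\<^sub>0" unfolding tau_hat_def \<tau>_def S_def .
      then show ?thesis using \<tau> unfolding fail_def by blast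
    qed
    then have "\<forall>b\<in>{1..d}. \<exists>\<tau>\<in>Pow {1..p} - {\<tau>\<^sub>0}. fail (?Y \<omega> b) (?Y \<omega> 0) \<tau>" by simp
    moreover have "?Y \<omega> \<in> space K" using measurable_space[OF Y] \<omega> by blast
    ultimately have "?Y \<omega> \<in> W" unfolding W_def by blast
    then show "\<omega> \<in> ?Y -` W \<inter> space M" using \<omega> by blast
  qed
  then have "measure M ?E \<le> measure M (?Y -` W \<inter> space M)"
    using measurable_sets[OF Y W_sets] by (intro M.finite_measure_mono) auto
  also have "\<dots> = measure K W"
    using measure_distr[OF Y, of W] W_sets by (simp add: distr)
  also note W_le
  also have "measure N {u \<in> space N. \<exists>\<tau>\<in>small_models. aligned u \<tau>} ^ d
      \<le> exp (real m * ln (real p) + 2 - (real n - real m) / 2) ^ d"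
    by (intro power_mono prob_ex_aligned assms) auto
  finally show ?thesis unfolding miss_prob_def by simp
qed

end

section \<open>The theorem\<close>

lemma repro_setup_of_model:
  assumes model: "repro_model M d U Ustar n p X \<tau>\<^sub>0 \<beta>\<^sub>0" and "0 < \<sigma>\<^sub>0" "0 < t" "0 < lam"
    and range: "lam / real n \<in> {6 * \<sigma>\<^sub>0\<^sup>2 * ((real (card \<tau>\<^sub>0) + 1) * ln (real p / 2) / real n) + t
                        .. 0.05 * C_min n p X \<tau>\<^sub>0 \<beta>\<^sub>0}"
  shows "repro_setup n p X \<tau>\<^sub>0 \<beta>\<^sub>0 \<sigma>\<^sub>0 lam t"
proof
  show n: "0 < n" and "\<tau>\<^sub>0 \<subseteq> {1..p}" "\<tau>\<^sub>0 \<noteq> {}" using model by (auto simp: repro_model_def)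
  show "6 * \<sigma>\<^sub>0\<^sup>2 * (real (card \<tau>\<^sub>0) + 1) * ln (real p / 2) + real n * t \<le> lam"
    and "lam \<le> 0.05 * (real n * C_min n p X \<tau>\<^sub>0 \<beta>\<^sub>0)"
  proof -
    let ?A = "6 * \<sigma>\<^sub>0\<^sup>2 * (real (card \<tau>\<^sub>0) + 1) * ln (real p / 2)"
    have "6 * \<sigma>\<^sub>0\<^sup>2 * ((real (card \<tau>\<^sub>0) + 1) * ln (real p / 2) / real n) + t = (?A + real n * t) / real n"
      using n by (simp add: add_divide_distrib)
    then have "(?A + real n * t) / real n \<le> lam / real n" using range by simp
    then show "?A + real n * t \<le> lam" using n by (simp add: divide_le_cancel)
    show "lam \<le> 0.05 * (real n * C_min n p X \<tau>\<^sub>0 \<beta>\<^sub>0)" using range n by (simp add: field_simps)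
  qed
qed fact+

section \<open>Estimates for the finite-sample bound and for the limit\<close>

context repro_setup
begin

lemma bound_eq:
  "bound = 6 * exp (- (real n / (18 * \<sigma>\<^sub>0\<^sup>2))
                       * (0.3 * C_min n p X \<tau>\<^sub>0 \<beta>\<^sub>0 - 36 * (ln (real p + 1) / real n) * \<sigma>\<^sub>0\<^sup>2))
            + 3 * exp (- (real n * t / (3 * \<sigma>\<^sub>0\<^sup>2)))"
proof -
  have "- (real n / (18 * \<sigma>\<^sub>0\<^sup>2)) * (0.3 * C_min n p X \<tau>\<^sub>0 \<beta>\<^sub>0 - 36 * (ln (real p + 1) / real n) * \<sigma>\<^sub>0\<^sup>2)
      = 2 * ln (real p + 1) + - D / (60 * \<sigma>\<^sub>0\<^sup>2)"
    using n \<sigma>\<^sub>0 by (simp add: field_simps)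
  moreover have "exp (2 * ln (real p + 1)) = (real p + 1)\<^sup>2"
    using exp_of_nat_mult[of 2 "ln (real p + 1)"] by (simp add: add_pos_nonneg add.commute)
  ultimately show ?thesis unfolding bound_def q_def by (simp only: exp_add mult.assoc)
qed

text \<open>The constant is \<open>23/100\<close> divided by \<open>2/3\<close>, a lower bound for
  \<open>ln 2\<close>. For \<open>p = 1\<close> the logarithm vanishes, and \<open>m \<le> 1\<close>
  with \<open>n \<ge> 3\<close> is used instead.\<close>

lemma m_le_fraction:
  assumes "real m * ln (real p) < 23/100 * real n" "3 \<le> n"
  shows "real m \<le> 69/200 * real n"
proof (cases "p \<le> 1")
  case True
  then have "real m \<le> 1" using m_le by simp
  also have "\<dots> \<le> 69/200 * real n" using assms(2) by simp
  finally show ?thesis .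
next
  case False
  have "real m * (2/3) \<le> real m * ln (real p)"
  proof (rule mult_left_mono)
    have "ln 2 \<le> ln (real p)" using False by simp
    then show "2/3 \<le> ln (real p)" using ln2_ge_two_thirds by linarith
  qed simp
  then show ?thesis using assms(1) by simp
qed

text \<open>Since \<open>20 * lam \<le> D\<close>, a lower bound on \<open>lam\<close> suffices.
  \<open>ln (real p / 2)\<close> is negative only for \<open>p = 1\<close>; then
  \<open>m = 1\<close> and the logarithmic term is at least
  \<open>- 12 * \<sigma>\<^sub>0\<^sup>2\<close>, which 20 turns into 240.\<close>

lemma D_ge: "20 * real n * t - 240 * \<sigma>\<^sub>0\<^sup>2 \<le> D"
proof -
  have "- (12 * \<sigma>\<^sub>0\<^sup>2) \<le> 6 * \<sigma>\<^sub>0\<^sup>2 * (real m + 1) * ln (real p / 2)"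
  proof (cases "p \<le> 1")
    case True
    then have "m = 1" "p = 1" using m_pos m_le by auto
    have "ln 2 \<le> (1 :: real)" using ln_le_minus_one[of "2 :: real"] by simp
    then have "12 * \<sigma>\<^sub>0\<^sup>2 * ln 2 \<le> 12 * \<sigma>\<^sub>0\<^sup>2 * 1" by (intro mult_left_mono) auto
    then show ?thesis unfolding \<open>m = 1\<close> \<open>p = 1\<close> by (simp add: ln_div)
  next
    case False
    then have "0 \<le> 6 * \<sigma>\<^sub>0\<^sup>2 * (real m + 1) * ln (real p / 2)" by (intro mult_nonneg_nonneg) auto
    moreover have "0 \<le> \<sigma>\<^sub>0\<^sup>2" by simp
    ultimately show ?thesis by linarith
  qed
  moreover have "20 * lam \<le> D" using lam_le by simp
  ultimately show ?thesis using lam_ge by linarith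
qed

text \<open>As \<open>m \<ge> 1\<close>, the hypothesis bounds \<open>(p + 1)\<^sup>2\<close> by
  \<open>exp (D / (180 * \<sigma>\<^sub>0\<^sup>2))\<close>, which uses up a third of the exponent
  of \<open>q\<close>. By \<open>D_ge\<close> the remaining two thirds grow linearly in
  \<open>n\<close>.\<close>

lemma bound_le:
  assumes "C_min n p X \<tau>\<^sub>0 \<beta>\<^sub>0 > 120 * ((real m + 2) * ln (real p + 1) / real n) * \<sigma>\<^sub>0\<^sup>2"
  shows "bound \<le> 6 * exp (- (20 * real n * t - 240 * \<sigma>\<^sub>0\<^sup>2) / (90 * \<sigma>\<^sub>0\<^sup>2))
            + 3 * exp (- (real n * t / (3 * \<sigma>\<^sub>0\<^sup>2)))"
proof -
  define L where "L = ln (real p + 1)"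
  have L: "0 \<le> L" by (simp add: L_def)
  have "120 * \<sigma>\<^sub>0\<^sup>2 * (3 * L) \<le> 120 * \<sigma>\<^sub>0\<^sup>2 * ((real m + 2) * L)"
    using m_pos L by (intro mult_left_mono mult_right_mono) auto
  also have "\<dots> \<le> D" using assms n by (simp add: L_def field_simps)
  finally have LD: "2 * L \<le> D / (180 * \<sigma>\<^sub>0\<^sup>2)"
    using \<sigma>\<^sub>0 by (simp add: pos_le_divide_eq mult_ac)
  have e: "(real p + 1)\<^sup>2 = exp (2 * L)"
    using exp_of_nat_mult[of 2 L] by (simp add: L_def add_pos_nonneg add.commute)
  have "(real p + 1)\<^sup>2 * q = exp (2 * L + - D / (60 * \<sigma>\<^sub>0\<^sup>2))"
    unfolding q_def e by (simp only: exp_add)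
  also have "\<dots> \<le> exp (- D / (90 * \<sigma>\<^sub>0\<^sup>2))"
  proof -
    have "D / (60 * \<sigma>\<^sub>0\<^sup>2) = 3 * (D / (180 * \<sigma>\<^sub>0\<^sup>2))" "D / (90 * \<sigma>\<^sub>0\<^sup>2) = 2 * (D / (180 * \<sigma>\<^sub>0\<^sup>2))"
      by simp_all
    then show ?thesis using LD unfolding exp_le_cancel_iff minus_divide_left[symmetric] by linarith
  qed
  also have "\<dots> \<le> exp (- (20 * real n * t - 240 * \<sigma>\<^sub>0\<^sup>2) / (90 * \<sigma>\<^sub>0\<^sup>2))"
  proof -
    have "- D / (90 * \<sigma>\<^sub>0\<^sup>2) \<le> - (20 * real n * t - 240 * \<sigma>\<^sub>0\<^sup>2) / (90 * \<sigma>\<^sub>0\<^sup>2)"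
      by (rule divide_right_mono) (use D_ge in simp_all)
    then show ?thesis by (simp only: exp_le_cancel_iff)
  qed
  finally show ?thesis unfolding bound_def by simp
qed

end

lemma miss_prob_nonneg: "0 \<le> miss_prob M tb d U Ustar n p X \<tau>\<^sub>0 \<beta>\<^sub>0 \<sigma>\<^sub>0 lam"
  by (simp add: miss_prob_def)

lemma miss_prob_finite_sample:
  assumes model: "repro_model M d U Ustar n p X \<tau>\<^sub>0 \<beta>\<^sub>0"
    and params: "repro_setup n p X \<tau>\<^sub>0 \<beta>\<^sub>0 \<sigma>\<^sub>0 lam t" and d: "1 \<le> d" and tb: "tie_breaking tb"
  shows "miss_prob M tb d U Ustar n p X \<tau>\<^sub>0 \<beta>\<^sub>0 \<sigma>\<^sub>0 lam
          \<le> 6 * exp (- (real n / (18 * \<sigma>\<^sub>0\<^sup>2))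
                       * (0.3 * C_min n p X \<tau>\<^sub>0 \<beta>\<^sub>0 - 36 * (ln (real p + 1) / real n) * \<sigma>\<^sub>0\<^sup>2))
            + 3 * exp (- (real n * t / (3 * \<sigma>\<^sub>0\<^sup>2)))
            + exp (- (real n * real d
                       * (0.23 - (real (card \<tau>\<^sub>0) * ln (real p) + 2) / real n)))"
proof -
  interpret repro_setup n p X \<tau>\<^sub>0 \<beta>\<^sub>0 \<sigma>\<^sub>0 lam t by (rule params)
  have noise: "gaussian_noise M n d U Ustar" using model by (simp add: repro_model_def)
  then interpret M: prob_space M by (simp add: gaussian_noise_def)
  have dec: "0.23 = (23/100 :: real)" by simp
  define z where "z = real m * ln (real p) + 2"
  have z: "real n * real d * (23/100 - z / real n) = real d * (23/100 * real n - z)"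
    using n by (simp add: field_simps)
  have "miss_prob M tb d U Ustar n p X \<tau>\<^sub>0 \<beta>\<^sub>0 \<sigma>\<^sub>0 lam \<le> bound + exp (- (real d * (23/100 * real n - z)))"
  \<comment> \<open>If this fails, the third term is at least 1. If it holds,
    \<open>m \<le> 69/200 * n\<close>, so the rate \<open>(n - m) / 2\<close> is at least
    \<open>131/400 * n\<close>, more than the claimed \<open>23/100 * n\<close>.\<close>
  proof (cases "z < 23/100 * real n")
    case True
    have "1 \<le> real p" using m_pos m_le by linarith
    then have "0 \<le> real m * ln (real p)" by (intro mult_nonneg_nonneg) auto
    then have "2 \<le> z" by (simp add: z_def)
    then have "3 \<le> real n" using True by linarith
    then have "3 \<le> n" by simp
    then have m: "real m \<le> 69/200 * real n" using True by (intro m_le_fraction) (auto simp: z_def)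
    then have "real m \<le> real n" by simp
    then have "m \<le> n" by simp
    from miss_prob_le[OF d tb noise this]
    have "miss_prob M tb d U Ustar n p X \<tau>\<^sub>0 \<beta>\<^sub>0 \<sigma>\<^sub>0 lam \<le> bound + exp (z - (real n - real m) / 2) ^ d"
      by (simp add: z_def)
    also have "exp (z - (real n - real m) / 2) ^ d \<le> exp (- (23/100 * real n - z)) ^ d"
      using m by (intro power_mono) auto
    also have "\<dots> = exp (- (real d * (23/100 * real n - z)))" by (simp add: exp_of_nat_mult[symmetric] algebra_simps)
    finally show ?thesis by simp
  next
    case False
    have "miss_prob M tb d U Ustar n p X \<tau>\<^sub>0 \<beta>\<^sub>0 \<sigma>\<^sub>0 lam \<le> 1" by (simp add: miss_prob_def)
    also have "\<dots> \<le> exp (- (real d * (23/100 * real n - z)))"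
      using False by (simp add: mult_nonneg_nonpos)
    also have "\<dots> \<le> bound + exp (- (real d * (23/100 * real n - z)))" by (simp add: bound_def q_def)
    finally show ?thesis .
  qed
  then show ?thesis unfolding z[symmetric] unfolding bound_eq z_def dec .
qed

text \<open>\<open>(n - m) / 2 \<ge> 131/400 * n\<close> exceeds \<open>23/100 * n\<close> by
  \<open>39/400 * n\<close>, so a fixed exponential rate survives however close the sparsity ratio
  comes to \<open>0.23\<close>.\<close>

lemma miss_prob_large_n:
  assumes model: "repro_model M d U Ustar n p X \<tau>\<^sub>0 \<beta>\<^sub>0"
    and params: "repro_setup n p X \<tau>\<^sub>0 \<beta>\<^sub>0 \<sigma>\<^sub>0 lam t" and d: "1 \<le> d" and tb: "tie_breaking tb"
    and large: "21 \<le> n"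
    and sparse: "real (card \<tau>\<^sub>0) * ln (real p) / real n < 0.23"
    and C: "C_min n p X \<tau>\<^sub>0 \<beta>\<^sub>0 > 120 * ((real (card \<tau>\<^sub>0) + 2) * ln (real p + 1) / real n) * \<sigma>\<^sub>0\<^sup>2"
  shows "miss_prob M tb d U Ustar n p X \<tau>\<^sub>0 \<beta>\<^sub>0 \<sigma>\<^sub>0 lam
           \<le> 6 * exp (- (20 * real n * t - 240 * \<sigma>\<^sub>0\<^sup>2) / (90 * \<sigma>\<^sub>0\<^sup>2))
             + 3 * exp (- (real n * t / (3 * \<sigma>\<^sub>0\<^sup>2))) + exp (2 - 39/400 * real n)"
proof -
  interpret repro_setup n p X \<tau>\<^sub>0 \<beta>\<^sub>0 \<sigma>\<^sub>0 lam t by (rule params)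
  have noise: "gaussian_noise M n d U Ustar" using model by (simp add: repro_model_def)
  have sp: "real m * ln (real p) < 23/100 * real n" using sparse large by (simp add: field_simps)
  then have m: "real m \<le> 69/200 * real n" using large by (intro m_le_fraction) auto
  then have "real m \<le> real n" by simp
  then have "m \<le> n" by simp
  have "exp (real m * ln (real p) + 2 - (real n - real m) / 2) ^ d \<le> exp (2 - 39/400 * real n) ^ d"
  proof (rule power_mono)
    have "real m * ln (real p) + 2 - (real n - real m) / 2 \<le> 2 - 39/400 * real n"
      using sp m by (simp add: field_simps)
    then show "exp (real m * ln (real p) + 2 - (real n - real m) / 2) \<le> exp (2 - 39/400 * real n)" by simp
  qed simp
  \<comment> \<open>\<open>n \<ge> 21\<close> makes the exponent negative, so the base is below 1
    and the power \<open>d \<ge> 1\<close> may be lowered to 1.\<close>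
  also have "\<dots> \<le> exp (2 - 39/400 * real n) ^ 1"
    using large d by (intro power_decreasing) auto
  finally show ?thesis using miss_prob_le[OF d tb noise \<open>m \<le> n\<close>] bound_le[OF C] by simp
qed

lemma large_n_bound_tendsto_0:
  fixes s t :: real
  assumes "0 < s" "0 < t"
  shows "(\<lambda>n. 6 * exp (- (20 * real n * t - 240 * s\<^sup>2) / (90 * s\<^sup>2))
             + 3 * exp (- (real n * t / (3 * s\<^sup>2))) + exp (2 - 39/400 * real n)) \<longlonglongrightarrow> 0"
proof -
  have decay: "(\<lambda>n. exp (b - a * real n)) \<longlonglongrightarrow> 0" if "0 < a" for a b :: real
    using that by real_asymp
  have "- (20 * real n * t - 240 * s\<^sup>2) / (90 * s\<^sup>2) = 8/3 - 2 * t / (9 * s\<^sup>2) * real n"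
    "- (real n * t / (3 * s\<^sup>2)) = 0 - t / (3 * s\<^sup>2) * real n" for n
    using assms by (simp_all add: field_simps)
  then show ?thesis
    using assms by (simp only:) (intro tendsto_add_zero tendsto_mult_right_zero decay; simp)
qed

theorem theorem2:
  fixes \<sigma>\<^sub>0 t :: real and d :: nat and tb :: "nat set set \<Rightarrow> nat set"
  assumes "\<sigma>\<^sub>0 > 0" and "t > 0" and "d \<ge> 1" and "tie_breaking tb"
  shows
    "(\<forall>(M :: 'a measure) U Ustar n p X \<tau>\<^sub>0 \<beta>\<^sub>0 lam.
        repro_model M d U Ustar n p X \<tau>\<^sub>0 \<beta>\<^sub>0 \<longrightarrow>
        lam > 0 \<longrightarrow>
        lam / real n \<in> {6 * \<sigma>\<^sub>0\<^sup>2 * ((real (card \<tau>\<^sub>0) + 1) * ln (real p / 2) / real n) + t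
                        .. 0.05 * C_min n p X \<tau>\<^sub>0 \<beta>\<^sub>0} \<longrightarrow>
        miss_prob M tb d U Ustar n p X \<tau>\<^sub>0 \<beta>\<^sub>0 \<sigma>\<^sub>0 lam
          \<le> 6 * exp (- (real n / (18 * \<sigma>\<^sub>0\<^sup>2))
                       * (0.3 * C_min n p X \<tau>\<^sub>0 \<beta>\<^sub>0 - 36 * (ln (real p + 1) / real n) * \<sigma>\<^sub>0\<^sup>2))
            + 3 * exp (- (real n * t / (3 * \<sigma>\<^sub>0\<^sup>2)))
            + exp (- (real n * real d
                       * (0.23 - (real (card \<tau>\<^sub>0) * ln (real p) + 2) / real n))))
     \<and>
     (\<forall>(M :: nat \<Rightarrow> 'a measure) U Ustar (p :: nat \<Rightarrow> nat) X \<tau>\<^sub>0 \<beta>\<^sub>0 (lam :: nat \<Rightarrow> real).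
        (\<forall>n\<ge>1. repro_model (M n) d (U n) (Ustar n) n (p n) (X n) (\<tau>\<^sub>0 n) (\<beta>\<^sub>0 n) \<and>
                lam n > 0 \<and>
                lam n / real n
                  \<in> {6 * \<sigma>\<^sub>0\<^sup>2 * ((real (card (\<tau>\<^sub>0 n)) + 1) * ln (real (p n) / 2) / real n) + t
                      .. 0.05 * C_min n (p n) (X n) (\<tau>\<^sub>0 n) (\<beta>\<^sub>0 n)}) \<longrightarrow>
        (\<forall>\<^sub>F n in sequentially.
           real (card (\<tau>\<^sub>0 n)) * ln (real (p n)) / real n < 0.23 \<and>
           C_min n (p n) (X n) (\<tau>\<^sub>0 n) (\<beta>\<^sub>0 n)
             > 120 * ((real (card (\<tau>\<^sub>0 n)) + 2) * ln (real (p n) + 1) / real n) * \<sigma>\<^sub>0\<^sup>2) \<longrightarrow>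
        (\<lambda>n. miss_prob (M n) tb d (U n) (Ustar n) n (p n) (X n) (\<tau>\<^sub>0 n) (\<beta>\<^sub>0 n) \<sigma>\<^sub>0 (lam n))
          \<longlonglongrightarrow> 0)"
proof (intro conjI allI impI)
  fix M :: "'a measure" and U Ustar n p X \<tau>\<^sub>0 \<beta>\<^sub>0 lam
  assume model: "repro_model M d U Ustar n p X \<tau>\<^sub>0 \<beta>\<^sub>0" and lam: "lam > 0"
    and range: "lam / real n \<in> {6 * \<sigma>\<^sub>0\<^sup>2 * ((real (card \<tau>\<^sub>0) + 1) * ln (real p / 2) / real n) + t
                        .. 0.05 * C_min n p X \<tau>\<^sub>0 \<beta>\<^sub>0}"
  show "miss_prob M tb d U Ustar n p X \<tau>\<^sub>0 \<beta>\<^sub>0 \<sigma>\<^sub>0 lam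
          \<le> 6 * exp (- (real n / (18 * \<sigma>\<^sub>0\<^sup>2))
                       * (0.3 * C_min n p X \<tau>\<^sub>0 \<beta>\<^sub>0 - 36 * (ln (real p + 1) / real n) * \<sigma>\<^sub>0\<^sup>2))
            + 3 * exp (- (real n * t / (3 * \<sigma>\<^sub>0\<^sup>2)))
            + exp (- (real n * real d
                       * (0.23 - (real (card \<tau>\<^sub>0) * ln (real p) + 2) / real n)))"
    by (rule miss_prob_finite_sample[OF model repro_setup_of_model[OF model assms(1,2) lam range]
          assms(3,4)])
next
  fix M :: "nat \<Rightarrow> 'a measure" and U Ustar and p :: "nat \<Rightarrow> nat" and X \<tau>\<^sub>0 \<beta>\<^sub>0
    and lam :: "nat \<Rightarrow> real"
  let ?range = "\<lambda>n. {6 * \<sigma>\<^sub>0\<^sup>2 * ((real (card (\<tau>\<^sub>0 n)) + 1) * ln (real (p n) / 2) / real n) + t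
                      .. 0.05 * C_min n (p n) (X n) (\<tau>\<^sub>0 n) (\<beta>\<^sub>0 n)}"
  assume hyp: "\<forall>n\<ge>1. repro_model (M n) d (U n) (Ustar n) n (p n) (X n) (\<tau>\<^sub>0 n) (\<beta>\<^sub>0 n) \<and>
                lam n > 0 \<and> lam n / real n \<in> ?range n"
  assume ev: "\<forall>\<^sub>F n in sequentially.
           real (card (\<tau>\<^sub>0 n)) * ln (real (p n)) / real n < 0.23 \<and>
           C_min n (p n) (X n) (\<tau>\<^sub>0 n) (\<beta>\<^sub>0 n)
             > 120 * ((real (card (\<tau>\<^sub>0 n)) + 2) * ln (real (p n) + 1) / real n) * \<sigma>\<^sub>0\<^sup>2"
  show "(\<lambda>n. miss_prob (M n) tb d (U n) (Ustar n) n (p n) (X n) (\<tau>\<^sub>0 n) (\<beta>\<^sub>0 n) \<sigma>\<^sub>0 (lam n))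
          \<longlonglongrightarrow> 0"
  proof (rule tendsto_sandwich[OF _ _ tendsto_const large_n_bound_tendsto_0[OF assms(1,2)]])
    show "\<forall>\<^sub>F n in sequentially.
        miss_prob (M n) tb d (U n) (Ustar n) n (p n) (X n) (\<tau>\<^sub>0 n) (\<beta>\<^sub>0 n) \<sigma>\<^sub>0 (lam n)
        \<le> 6 * exp (- (20 * real n * t - 240 * \<sigma>\<^sub>0\<^sup>2) / (90 * \<sigma>\<^sub>0\<^sup>2))
          + 3 * exp (- (real n * t / (3 * \<sigma>\<^sub>0\<^sup>2))) + exp (2 - 39/400 * real n)"
      using ev eventually_ge_at_top[of 21]
    proof eventually_elim
      case (elim n)
      then have "1 \<le> n" by simp
      with hyp have h: "repro_model (M n) d (U n) (Ustar n) n (p n) (X n) (\<tau>\<^sub>0 n) (\<beta>\<^sub>0 n)"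
        "0 < lam n" "lam n / real n \<in> ?range n" by blast+
      show ?case
        by (rule miss_prob_large_n[OF h(1) repro_setup_of_model[OF h(1) assms(1,2) h(2,3)] assms(3,4)])
          (use elim in blast)+
    qed
  qed (simp add: miss_prob_nonneg)
qed

end
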